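(* Let $G$ be a finite simple connected graph containing a cycle. If $g=\operatorname{g}(G)$ and $f=f(G)$, then $$\operatorname{t}(G)\ \ge\ f+\left\lceil\frac{2g}{3}\right\rceil .$$ Consequently every finite simple connected graph $G$ (with or without a cycle) satisfies $$\operatorname{t}(G)\ \ge\ \frac23\operatorname{g}(G)+f(G),$$ where $\operatorname{g}(G):=0$ if $G$ is acyclic.
   Context: For a finite simple connected (hence nonempty) graph $G$ with graph distance $d$: $\operatorname{t}(G)$ is the maximum of $|S|$ over vertex sets $S\subseteq V(G)$ such that the induced subgraph $G[S]$ is a tree (connected and acyclic). The girth $\operatorname{g}(G)$ is the minimum length of a cycle of $G$ if $G$ contains a cycle, and is taken to be $0$ if $G$ is acyclic. The periphery $\operatorname{Per}(G)$ is the set of vertices whose eccentricity equals the diameter $\operatorname{diam}(G)$. For a vertex $x$, $d(x,\operatorname{Per}(G))=\min_{y\in\operatorname{Per}(G)}d(x,y)$, and $$f(G):=\max_{x\in V(G)}d(x,\operatorname{Per}(G)).$$ *)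

theory Defs
  imports "Graph_Theory.Graph_Theory"
begin

text \<open>
  A finite simple graph is a symmetric, loop-free digraph without parallel arcs on a finite vertex
  set (locale \<^locale>\<open>graph\<close>): each undirected edge is represented by two opposite arcs.  The
  predicate \<^const>\<open>Digraph_Component.connected\<close> includes nonemptiness.
\<close>

text \<open>
  In a symmetric digraph \<^const>\<open>pre_digraph.cycle\<close> also admits going back and forth along one edge.
  In a simple graph these closed walks have length 2, and the remaining ones are exactly the
  cycles of the undirected graph.  The library constants \<open>forest\<close> and \<open>tree\<close> use
  the directed notion of cycle and hence cannot be used here.
\<close>

definition undirected_cycle :: "('a,'b) pre_digraph \<Rightarrow> 'b list \<Rightarrow> bool" where
  "undirected_cycle G p \<longleftrightarrow> pre_digraph.cycle G p \<and> 3 \<le> length p"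

definition acyclic_graph :: "('a,'b) pre_digraph \<Rightarrow> bool" where
  "acyclic_graph G \<longleftrightarrow> (\<nexists>p. undirected_cycle G p)"

definition undirected_tree :: "('a,'b) pre_digraph \<Rightarrow> bool" where
  "undirected_tree G \<longleftrightarrow> Digraph_Component.connected G \<and> acyclic_graph G"

definition induced_tree_number :: "('a,'b) pre_digraph \<Rightarrow> nat" where
  "induced_tree_number G = Max {card S |S. S \<subseteq> verts G \<and> undirected_tree (G \<restriction> S)}"

definition girth :: "('a,'b) pre_digraph \<Rightarrow> nat" where
  "girth G = (if acyclic_graph G then 0 else LEAST n. \<exists>p. undirected_cycle G p \<and> length p = n)"

text \<open>Meaningful only if \<open>v\<close> is reachable from \<open>u\<close>.\<close>

definition graph_dist :: "('a,'b) pre_digraph \<Rightarrow> 'a \<Rightarrow> 'a \<Rightarrow> nat" where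
  "graph_dist G u v = (LEAST n. \<exists>p. pre_digraph.awalk G u p v \<and> length p = n)"

definition eccentricity :: "('a,'b) pre_digraph \<Rightarrow> 'a \<Rightarrow> nat" where
  "eccentricity G v = Max {graph_dist G v u |u. u \<in> verts G}"

definition graph_diameter :: "('a,'b) pre_digraph \<Rightarrow> nat" where
  "graph_diameter G = Max {graph_dist G u v |u v. u \<in> verts G \<and> v \<in> verts G}"

definition periphery :: "('a,'b) pre_digraph \<Rightarrow> 'a set" where
  "periphery G = {v \<in> verts G. eccentricity G v = graph_diameter G}"

definition dist_to_set :: "('a,'b) pre_digraph \<Rightarrow> 'a \<Rightarrow> 'a set \<Rightarrow> nat" where
  "dist_to_set G x A = Min {graph_dist G x y |y. y \<in> A}"

text \<open>The invariant \<open>f(G)\<close>.\<close>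

definition max_dist_periphery :: "('a,'b) pre_digraph \<Rightarrow> nat" where
  "max_dist_periphery G = Max {dist_to_set G x (periphery G) |x. x \<in> verts G}"

text \<open>The distance agrees with the library's shortest-path cost for unit weights.\<close>

lemma (in wf_digraph) unit_cost_eq_graph_dist:
  assumes "u \<rightarrow>\<^sup>* v"
  shows "\<mu> (\<lambda>_. 1) u v = ereal (real (graph_dist G u v))"
proof -
  have cost: "awalk_cost (\<lambda>_. 1) p = real (length p)" for p
    by (induction p) auto
  obtain q where "awalk u q v"
    using assms by (auto simp: reachable_awalk)
  then have "\<exists>p. awalk u p v \<and> length p = length q" by blast
  then have "\<exists>p. awalk u p v \<and> length p = graph_dist G u v"
    unfolding graph_dist_def by (rule LeastI)
  then obtain p where p: "awalk u p v" "length p = graph_dist G u v" by blast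
  have le: "graph_dist G u v \<le> length r" if "awalk u r v" for r
    unfolding graph_dist_def by (rule Least_le) (use that in blast)
  show ?thesis
    unfolding \<mu>_def cost
  proof (rule antisym)
    show "(INF p\<in>{p. awalk u p v}. ereal (real (length p))) \<le> ereal (real (graph_dist G u v))"
      using p by (intro INF_lower2[of p]) auto
    show "ereal (real (graph_dist G u v)) \<le> (INF p\<in>{p. awalk u p v}. ereal (real (length p)))"
      using le by (intro INF_greatest) auto
  qed
qed

end

theory Submission
  imports Defs
begin

text \<open>
  Let \<open>u\<close>, \<open>v\<close> realise the diameter \<open>D\<close>, let \<open>x\<close> be a vertex at distance \<open>f\<close> from the periphery,
  and let \<open>C\<close> be a shortest cycle, of length \<open>g \<ge> 5\<close>.  Shortest paths (rays) from \<open>u\<close>, \<open>v\<close>, \<open>x\<close> to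
  \<open>C\<close> are attached to \<open>C\<close> minus a vertex.  If two of these rays meet or are joined by an edge outside
  \<open>C\<close>, there is even an induced tree with \<open>g + f\<close> vertices.  Otherwise the union of the three rays
  and \<open>C\<close> minus a vertex is an induced tree, so if \<open>t < f + g - \<lfloor>g/3\<rfloor>\<close>, the total length \<open>s\<close> of the
  rays is at most \<open>f - \<lfloor>g/3\<rfloor>\<close>.  The feet of the rays have pairwise distances on \<open>C\<close> summing to at
  most \<open>g\<close>, whence \<open>D + 2 f \<le> 2 s + g\<close> and \<open>D \<le> g - 2 \<lfloor>g/3\<rfloor>\<close>.  On the other hand \<open>C\<close> is isometric,
  so \<open>D \<le> \<lfloor>g/2\<rfloor>\<close> would put all of \<open>C\<close> into the periphery, although \<open>x\<close> has distance less than \<open>f\<close>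
  from \<open>C\<close>.  This leaves only \<open>g = 5\<close>, \<open>D = 3\<close>, \<open>f = 2\<close>, where the graph would have to be a
  pentagon with one pendant vertex; but that graph has \<open>f = 1\<close>.  If \<open>f = 0\<close>, then \<open>C\<close> minus a vertex
  suffices.  For \<open>g \<le> 4\<close> a diametral path, extended by a vertex if necessary, is large enough.
\<close>

section \<open>Circuits as injective vertex sequences\<close>

lemma (in pre_digraph) cas_nth:
  "cas u p v \<Longrightarrow> i < length p \<Longrightarrow> tail G (p ! i) = (u # map (head G) p) ! i"
  by (induction p arbitrary: u i) (auto simp: nth_Cons split: nat.splits)

lemma (in pre_digraph) cas_last: "cas u p v \<Longrightarrow> last (u # map (head G) p) = v"
  by (induction p arbitrary: u) (auto split: if_splits)

lemma (in pre_digraph) cas_awalk_verts: "cas u p v \<Longrightarrow> awalk_verts u p = u # map (head G) p"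
  by (induction p arbitrary: u) auto

text \<open>Vertex sequences replace arc lists, so that exhibiting a cycle only takes injectivity
  and adjacencies. The bound \<open>3 \<le> n\<close> excludes going back and forth along one
  edge.\<close>

definition circuit :: "('a,'b) pre_digraph \<Rightarrow> (nat \<Rightarrow> 'a) \<Rightarrow> nat \<Rightarrow> bool" where
  "circuit G c n \<longleftrightarrow> 3 \<le> n \<and> inj_on c {..<n} \<and> (\<forall>i<n. c i \<rightarrow>\<^bsub>G\<^esub> c (Suc i mod n))"

lemma (in wf_digraph) circuit_of_undirected_cycle:
  assumes "undirected_cycle G p"
  shows "\<exists>c. circuit G c (length p)"
proof -
  let ?n = "length p"
  \<comment> \<open>Heads rather than tails: \<open>tl (awalk_verts u p)\<close>, which
    \<open>cycle\<close> requires to be distinct, is the list of heads.\<close>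
  define c where "c i = head G (p ! i)" for i
  from assms obtain u where n: "3 \<le> ?n" and w: "awalk u p u"
    and dist: "distinct (tl (awalk_verts u p))"
    by (auto simp: undirected_cycle_def cycle_def)
  have cas: "cas u p u" and arcs: "set p \<subseteq> arcs G" using w by auto
  have "distinct (map (head G) p)" using dist cas_awalk_verts[OF cas] by simp
  then have "inj_on c {..<?n}"
    by (auto simp: c_def inj_on_def distinct_conv_nth)
  moreover have "c i \<rightarrow>\<^bsub>G\<^esub> c (Suc i mod ?n)" if "i < ?n" for i
  proof -
    have j: "Suc i mod ?n < ?n" using n by (intro mod_less_divisor) auto
    have "tail G (p ! (Suc i mod ?n)) = c i"
    proof (cases "Suc i < ?n")
      case True
      then show ?thesis using cas_nth[OF cas, of "Suc i"] that by (simp add: c_def)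
    next
      case False
      with that have i: "Suc i = ?n" by simp
      have "p \<noteq> []" "i = length p - 1" using i n by auto
      then have "u = head G (p ! i)"
        using cas_last[OF cas] by (simp add: last_conv_nth)
      moreover have "Suc i mod ?n = 0" using i by simp
      ultimately show ?thesis using cas_nth[OF cas, of 0] \<open>p \<noteq> []\<close> by (simp add: c_def)
    qed
    moreover have "p ! (Suc i mod ?n) \<in> arcs G" using j arcs by (simp add: subset_iff)
    ultimately show ?thesis
      unfolding c_def arcs_ends_conv by (metis (no_types, lifting) image_eqI)
  qed
  ultimately show ?thesis using n by (auto simp: circuit_def)
qed

lemma (in wf_digraph) awalk_of_steps:
  assumes "c 0 \<in> verts G" "\<And>i. i < n \<Longrightarrow> e i \<in> arcs G \<and> tail G (e i) = c i \<and> head G (e i) = c (Suc i)"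
  shows "awalk (c 0) (map e [0..<n]) (c n)"
  using assms
proof (induction n)
  case (Suc n)
  then have "awalk (c 0) (map e [0..<n]) (c n)" "awalk (c n) [e n] (c (Suc n))"
    by (auto simp: awalk_simps simp del: head_in_verts) (metis head_in_verts lessI)
  then show ?case by auto
qed (auto simp: awalk_simps)

lemma (in wf_digraph) undirected_cycle_of_circuit:
  assumes "circuit G c n"
  shows "\<exists>p. undirected_cycle G p \<and> length p = n"
proof -
  \<comment> \<open>With the periodic extension, the closing arc is treated like all others, since
    \<open>c' n = c' 0\<close>.\<close>
  define c' where "c' i = c (i mod n)" for i
  have n: "3 \<le> n" and inj: "inj_on c {..<n}" and adj: "\<And>i. i < n \<Longrightarrow> c i \<rightarrow>\<^bsub>G\<^esub> c (Suc i mod n)"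
    using assms by (auto simp: circuit_def)
  have "\<exists>e. e \<in> arcs G \<and> tail G e = c' i \<and> head G e = c' (Suc i)" if "i < n" for i
    using adj[OF that] that by (auto simp: arcs_ends_conv c'_def)
  then obtain e where e: "\<And>i. i < n \<Longrightarrow> e i \<in> arcs G \<and> tail G (e i) = c' i \<and> head G (e i) = c' (Suc i)"
    by metis
  let ?p = "map e [0..<n]"
  have "c' 0 \<in> verts G" using adj[of 0] n adj_in_verts by (auto simp: c'_def)
  then have w: "awalk (c' 0) ?p (c' 0)"
    using awalk_of_steps[of c' n e] e by (simp add: c'_def)
  have "tl (awalk_verts (c' 0) ?p) = map (\<lambda>i. c' (Suc i)) [0..<n]"
    using cas_awalk_verts[of "c' 0" ?p] w e by (auto simp: awalk_def)
  moreover have "inj_on (\<lambda>i. c' (Suc i)) {..<n}"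
  proof (rule inj_onI)
    fix i j assume ij: "i \<in> {..<n}" "j \<in> {..<n}" "c' (Suc i) = c' (Suc j)"
    then have "Suc i mod n = Suc j mod n"
      using inj n by (auto simp: c'_def inj_on_def)
    with ij show "i = j" by (auto simp: mod_Suc split: if_splits)
  qed
  ultimately have "distinct (tl (awalk_verts (c' 0) ?p))"
    by (auto simp: distinct_map atLeast_upt)
  with w n have "undirected_cycle G ?p"
    by (auto simp: undirected_cycle_def cycle_def)
  then show ?thesis by (intro exI[of _ ?p]) simp
qed

lemma (in wf_digraph) girth_le_circuit: "circuit G c n \<Longrightarrow> girth G \<le> n"
  using undirected_cycle_of_circuit[of c n]
  by (auto simp: girth_def acyclic_graph_def intro: Least_le)

lemma (in wf_digraph) circuit_girth:
  assumes "undirected_cycle G p"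
  shows "\<exists>c. circuit G c (girth G)"
proof -
  have "\<exists>q. undirected_cycle G q \<and> length q = girth G"
    using assms LeastI[of "\<lambda>n. \<exists>q. undirected_cycle G q \<and> length q = n" "length p"]
    by (auto simp: girth_def acyclic_graph_def)
  then show ?thesis using circuit_of_undirected_cycle by metis
qed

lemma circuit_two_neighbours:
  assumes "circuit G c n" "i < n"
  shows "\<exists>j<n. \<exists>k<n. j \<noteq> k \<and> c j \<rightarrow>\<^bsub>G\<^esub> c i \<and> c i \<rightarrow>\<^bsub>G\<^esub> c k"
proof -
  have n: "3 \<le> n" and adj: "\<And>i. i < n \<Longrightarrow> c i \<rightarrow>\<^bsub>G\<^esub> c (Suc i mod n)"
    using assms by (auto simp: circuit_def)
  define j where "j = (if i = 0 then n - 1 else i - 1)"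
  have j: "j < n" "Suc j mod n = i" using n assms by (auto simp: j_def)
  have k: "Suc i mod n < n" "j \<noteq> Suc i mod n"
    using n assms by (auto simp: j_def mod_Suc)
  show ?thesis using adj[OF j(1)] adj[OF assms(2)] j k by metis
qed

section \<open>Distances and induced trees in connected graphs\<close>

locale connected_graph = graph +
  assumes conn: "Digraph_Component.connected G"
begin

abbreviation adj (infix "\<sim>" 50) where "u \<sim> v \<equiv> u \<rightarrow>\<^bsub>G\<^esub> v"
abbreviation \<delta> where "\<delta> \<equiv> graph_dist G"
abbreviation diam where "diam \<equiv> graph_diameter G"

lemma adj_sym: "u \<sim> v \<Longrightarrow> v \<sim> u"
  using sym_arcs by (auto simp: symmetric_def sym_def)

lemma adj_irrefl: "\<not> u \<sim> u"
  using adj_not_same by blast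

text \<open>In terms of relational powers the triangle inequality is \<open>relpow_add\<close>, and
  geodesics become vertex sequences by \<open>relpow_fun_conv\<close>.\<close>

lemma awalk_iff_relpow:
  "(\<exists>p. awalk u p v \<and> length p = n) \<longleftrightarrow> u \<in> verts G \<and> (u, v) \<in> arcs_ends G ^^ n"
proof (induction n arbitrary: u)
  case 0
  then show ?case by (auto simp: awalk_simps)
next
  case (Suc n)
  have "(\<exists>p. awalk u p v \<and> length p = Suc n) \<longleftrightarrow>
      (\<exists>e p. e \<in> arcs G \<and> tail G e = u \<and> awalk (head G e) p v \<and> length p = n)"
    by (auto simp: awalk_simps length_Suc_conv) (metis awalk_Cons_iff length_Cons)+
  also have "\<dots> \<longleftrightarrow> (\<exists>e. e \<in> arcs G \<and> tail G e = u \<and> (head G e, v) \<in> arcs_ends G ^^ n)"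
    using Suc.IH by (metis head_in_verts)
  also have "\<dots> \<longleftrightarrow> u \<in> verts G \<and> (\<exists>w. u \<sim> w \<and> (w, v) \<in> arcs_ends G ^^ n)"
    by (auto simp: arcs_ends_conv)
  also have "\<dots> \<longleftrightarrow> u \<in> verts G \<and> (u, v) \<in> arcs_ends G ^^ Suc n"
    using relpow_Suc_D2 relpow_Suc_I2 by (metis prod.inject)
  finally show ?case .
qed

lemma dist_Least: "u \<in> verts G \<Longrightarrow> \<delta> u v = (LEAST n. (u, v) \<in> arcs_ends G ^^ n)"
  by (simp add: graph_dist_def awalk_iff_relpow)

lemma dist_relpow:
  assumes "u \<in> verts G" "v \<in> verts G"
  shows "(u, v) \<in> arcs_ends G ^^ \<delta> u v"
proof -
  have "u \<rightarrow>\<^sup>* v"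
    using symmetric_connected_imp_strongly_connected[OF sym_arcs conn] assms
    by (auto simp: strongly_connected_def)
  then have "\<exists>n. (u, v) \<in> arcs_ends G ^^ n"
    using rtrancl_power reachable_rtranclI by metis
  then show ?thesis using LeastI_ex dist_Least[OF assms(1)] by metis
qed

lemma dist_le: "u \<in> verts G \<Longrightarrow> (u, v) \<in> arcs_ends G ^^ n \<Longrightarrow> \<delta> u v \<le> n"
  by (simp add: dist_Least Least_le)

lemma dist_self [simp]: "u \<in> verts G \<Longrightarrow> \<delta> u u = 0"
  using dist_le[of u u 0] by simp

lemma dist_eq_0: "u \<in> verts G \<Longrightarrow> v \<in> verts G \<Longrightarrow> \<delta> u v = 0 \<longleftrightarrow> u = v"
  using dist_relpow[of u v] by auto

lemma dist_adj: "u \<sim> v \<Longrightarrow> \<delta> u v \<le> 1"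
  using dist_le[of u v 1] adj_in_verts by auto

lemma dist_le_1: "u \<in> verts G \<Longrightarrow> v \<in> verts G \<Longrightarrow> \<delta> u v \<le> 1 \<Longrightarrow> u = v \<or> u \<sim> v"
  using dist_relpow[of u v] by (cases "\<delta> u v") auto

lemma dist_triangle:
  assumes "u \<in> verts G" "v \<in> verts G" "w \<in> verts G"
  shows "\<delta> u w \<le> \<delta> u v + \<delta> v w"
proof (rule dist_le[OF assms(1)])
  show "(u, w) \<in> arcs_ends G ^^ (\<delta> u v + \<delta> v w)"
    using dist_relpow[of u v] dist_relpow[of v w] assms by (auto simp: relpow_add)
qed

lemma relpow_adj_sym: "(u, v) \<in> arcs_ends G ^^ n \<Longrightarrow> (v, u) \<in> arcs_ends G ^^ n"
proof (induction n arbitrary: v)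
  case (Suc n)
  then obtain w where "(u, w) \<in> arcs_ends G ^^ n" "w \<sim> v" by auto
  then show ?case using Suc.IH adj_sym relpow_Suc_I2 by metis
qed auto

lemma dist_sym: "u \<in> verts G \<Longrightarrow> v \<in> verts G \<Longrightarrow> \<delta> u v = \<delta> v u"
proof -
  have "(u, v) \<in> arcs_ends G ^^ n \<longleftrightarrow> (v, u) \<in> arcs_ends G ^^ n" for n
    using relpow_adj_sym by blast
  then show "u \<in> verts G \<Longrightarrow> v \<in> verts G \<Longrightarrow> \<delta> u v = \<delta> v u"
    by (simp add: dist_Least)
qed

section \<open>Walks and geodesics as vertex sequences\<close>

definition walk :: "(nat \<Rightarrow> 'a) \<Rightarrow> nat \<Rightarrow> bool" where
  "walk q n \<longleftrightarrow> q 0 \<in> verts G \<and> (\<forall>i<n. q i \<sim> q (Suc i))"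

lemma walk_adj: "walk q n \<Longrightarrow> i < n \<Longrightarrow> q i \<sim> q (Suc i)"
  by (simp add: walk_def)

lemma geodesic:
  assumes "u \<in> verts G" "v \<in> verts G"
  obtains q where "q 0 = u" "q (\<delta> u v) = v" "walk q (\<delta> u v)"
  using dist_relpow[OF assms] assms unfolding relpow_fun_conv walk_def by blast

lemma walk_in_verts: "walk q n \<Longrightarrow> i \<le> n \<Longrightarrow> q i \<in> verts G"
  unfolding walk_def by (cases i) (auto dest!: Suc_le_lessD adj_in_verts(2))

lemma walk_dist_le:
  assumes "walk q n" "i \<le> j" "j \<le> n"
  shows "\<delta> (q i) (q j) \<le> j - i"
proof -
  have "i + k \<le> n \<longrightarrow> (q i, q (i + k)) \<in> arcs_ends G ^^ k" for k
  proof (induction k)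
    case (Suc k)
    then show ?case using walk_adj[OF assms(1), of "i + k"] by auto
  qed simp
  then have "(q i, q j) \<in> arcs_ends G ^^ (j - i)" using assms(2,3) by (metis le_add_diff_inverse)
  then show ?thesis using dist_le walk_in_verts[OF assms(1), of i] assms by simp
qed

text \<open>The hypothesis \<open>n \<le> \<delta> (q 0) (q n)\<close> makes \<open>q\<close> a
  shortest walk. Its three pieces have lengths at most \<open>i\<close>, \<open>j - i\<close> and
  \<open>n - j\<close>, and these must add up to at least \<open>n\<close>, so all bounds are
  attained.\<close>

lemma geodesic_dist:
  assumes "walk q n" "n \<le> \<delta> (q 0) (q n)" "i \<le> j" "j \<le> n"
  shows "\<delta> (q i) (q j) = j - i"
proof -
  note v = walk_in_verts[OF assms(1)]
  have "\<delta> (q 0) (q n) \<le> \<delta> (q 0) (q i) + \<delta> (q i) (q n)"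
    "\<delta> (q i) (q n) \<le> \<delta> (q i) (q j) + \<delta> (q j) (q n)"
    using assms(3,4) by (auto intro!: dist_triangle v)
  moreover have "\<delta> (q 0) (q i) \<le> i" "\<delta> (q i) (q j) \<le> j - i" "\<delta> (q j) (q n) \<le> n - j"
    using walk_dist_le[OF assms(1), of 0 i] walk_dist_le[OF assms(1), of i j]
      walk_dist_le[OF assms(1), of j n] assms(3,4) by simp_all
  ultimately show ?thesis using assms(2-4) by linarith
qed

text \<open>Vertex sets inducing trees, in the form in which all trees below are built: a new vertex
  has exactly one neighbour in the old set, which preserves connectedness and acyclicity at
  once.\<close>

inductive itree :: "'a set \<Rightarrow> bool" where
  single: "v \<in> verts G \<Longrightarrow> itree {v}"
| leaf: "itree S \<Longrightarrow> s \<in> S \<Longrightarrow> s \<sim> q \<Longrightarrow> q \<notin> S \<Longrightarrow> (\<And>t. t \<in> S \<Longrightarrow> t \<sim> q \<Longrightarrow> t = s) \<Longrightarrow> itree (insert q S)"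

lemma itree_subset: "itree S \<Longrightarrow> S \<subseteq> verts G"
  by (induction rule: itree.induct) (auto dest: adj_in_verts)

lemma adj_induce: "u \<sim> v \<Longrightarrow> u \<in> S \<Longrightarrow> v \<in> S \<Longrightarrow> u \<rightarrow>\<^bsub>G \<restriction> S\<^esub> v"
  by (auto simp: arcs_ends_conv)

lemma itree_strongly_connected: "itree S \<Longrightarrow> strongly_connected (G \<restriction> S)"
proof (induction rule: itree.induct)
  case (single v)
  interpret H: wf_digraph "G \<restriction> {v}" by auto
  show ?case by (auto simp: strongly_connected_def)
next
  case (leaf S s q)
  let ?H = "G \<restriction> insert q S"
  interpret H: wf_digraph ?H by auto
  have *: "u \<rightarrow>\<^sup>*\<^bsub>?H\<^esub> v" if "u \<in> S" "v \<in> S" for u v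
    using leaf.IH that reachable_induce_ss[of S u v "insert q S"] by (auto simp: strongly_connected_def)
  have sq: "s \<rightarrow>\<^bsub>?H\<^esub> q" "q \<rightarrow>\<^bsub>?H\<^esub> s" using leaf.hyps(2,3) adj_sym[OF leaf.hyps(3)] by (simp_all add: adj_induce)
  have **: "u \<rightarrow>\<^sup>*\<^bsub>?H\<^esub> s" "s \<rightarrow>\<^sup>*\<^bsub>?H\<^esub> u" if "u \<in> insert q S" for u
    using that sq * leaf.hyps(2) by auto
  have "u \<rightarrow>\<^sup>*\<^bsub>?H\<^esub> v" if "u \<in> insert q S" "v \<in> insert q S" for u v
    using **(1)[OF that(1)] **(2)[OF that(2)] by (rule H.reachable_trans)
  then show ?case by (simp add: strongly_connected_def)
qed

text \<open>The vertex of \<open>T\<close> that was added last has at most one neighbour in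
  \<open>T\<close>. This excludes circuits, on which every vertex has two neighbours.\<close>

lemma itree_no_cycle:
  assumes "itree S" "T \<subseteq> S" "T \<noteq> {}"
  shows "\<exists>v\<in>T. \<forall>a\<in>T. \<forall>b\<in>T. a \<sim> v \<longrightarrow> b \<sim> v \<longrightarrow> a = b"
  using assms
proof (induction arbitrary: T rule: itree.induct)
  case (single v)
  then show ?case by blast
next
  case (leaf S s q)
  show ?case
  proof (cases "q \<in> T")
    case True
    have "a = s" if "a \<in> T" "a \<sim> q" for a
      using that leaf adj_irrefl by blast
    then show ?thesis using True by blast
  next
    case False
    then show ?thesis using leaf by blast
  qed
qed

lemma itree_undirected_tree:
  assumes "itree S" shows "undirected_tree (G \<restriction> S)"
proof -
  interpret H: wf_digraph "G \<restriction> S" by auto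
  have "acyclic_graph (G \<restriction> S)" unfolding acyclic_graph_def
  proof
    assume "\<exists>p. undirected_cycle (G \<restriction> S) p"
    then obtain c n where c: "circuit (G \<restriction> S) c n" using H.circuit_of_undirected_cycle by blast
    define T where "T = c ` {..<n}"
    have inj: "inj_on c {..<n}" and n: "3 \<le> n" using c by (auto simp: circuit_def)
    have "T \<subseteq> S" using circuit_two_neighbours[OF c] H.adj_in_verts by (auto simp: T_def)
    moreover have "T \<noteq> {}" using n by (auto simp: T_def lessThan_empty_iff)
    ultimately obtain i where i: "i < n" and "\<forall>a\<in>T. \<forall>b\<in>T. a \<sim> c i \<longrightarrow> b \<sim> c i \<longrightarrow> a = b"
      using itree_no_cycle[OF assms] unfolding T_def by blast
    moreover obtain j k where "j < n" "k < n" "j \<noteq> k" "c j \<sim> c i" "c k \<sim> c i"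
      using circuit_two_neighbours[OF c i] by (meson adj_sym dominates_induce_subgraphD)
    ultimately show False using inj by (auto simp: T_def inj_on_def)
  qed
  moreover have "Digraph_Component.connected (G \<restriction> S)"
    using itree_strongly_connected[OF assms] H.reachable_mk_symmetricI
    by (auto simp: strongly_connected_def intro!: H.connectedI)
  ultimately show ?thesis by (simp add: undirected_tree_def)
qed

lemma itree_card_le:
  assumes "itree S" shows "card S \<le> induced_tree_number G"
proof -
  have "{card S |S. S \<subseteq> verts G \<and> undirected_tree (G \<restriction> S)} \<subseteq> card ` Pow (verts G)" by auto
  then have "finite {card S |S. S \<subseteq> verts G \<and> undirected_tree (G \<restriction> S)}"
    by (rule finite_subset) simp
  then show ?thesis unfolding induced_tree_number_def
    using itree_subset[OF assms] itree_undirected_tree[OF assms] by (auto intro!: Max_ge)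
qed

text \<open>The path is added leaf by leaf. Assumption \<open>S\<close> leaves the edge from
  \<open>q 0\<close> to \<open>q 1\<close> as the only one between the old set and the path, so each
  later vertex sees only its predecessor.\<close>

lemma itree_path:
  assumes "itree S" "q 0 \<in> S"
    and adj: "walk q n"
    and new: "\<And>i. 1 \<le> i \<Longrightarrow> i \<le> n \<Longrightarrow> q i \<notin> S"
    and S: "\<And>i s. 1 \<le> i \<Longrightarrow> i \<le> n \<Longrightarrow> s \<in> S \<Longrightarrow> s \<sim> q i \<Longrightarrow> i = 1 \<and> s = q 0"
    and chordless: "\<And>i j. 1 \<le> i \<Longrightarrow> i < j \<Longrightarrow> j \<le> n \<Longrightarrow> q i \<noteq> q j \<and> (q i \<sim> q j \<longrightarrow> j = Suc i)"
  shows "itree (S \<union> q ` {1..n}) \<and> card (S \<union> q ` {1..n}) = card S + n"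
  using adj new S chordless
proof (induction n)
  case 0
  then show ?case using assms(1) by simp
next
  case (Suc n)
  let ?S = "S \<union> q ` {1..n}"
  have IH: "itree ?S \<and> card ?S = card S + n"
  proof (rule Suc.IH)
    show "walk q n" using Suc.prems(1) by (simp add: walk_def)
    show "q i \<notin> S" if "1 \<le> i" "i \<le> n" for i using Suc.prems(2) that by simp
    show "i = 1 \<and> s = q 0" if "1 \<le> i" "i \<le> n" "s \<in> S" "s \<sim> q i" for i s
      using Suc.prems(3) that le_SucI by blast
    show "q i \<noteq> q j \<and> (q i \<sim> q j \<longrightarrow> j = Suc i)" if "1 \<le> i" "i < j" "j \<le> n" for i j
      using Suc.prems(4)[of i j] that by simp
  qed
  have eq: "S \<union> q ` {1..Suc n} = insert (q (Suc n)) ?S" by (auto simp: atLeastAtMostSuc_conv)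
  have notin: "q (Suc n) \<notin> ?S" using Suc.prems(2)[of "Suc n"] Suc.prems(4)[of _ "Suc n"] by force
  have "q n \<in> ?S" using assms(2) by (cases n) auto
  moreover have "t = q n" if "t \<in> ?S" "t \<sim> q (Suc n)" for t
    using that(1)
  proof
    assume "t \<in> S"
    then show ?thesis using Suc.prems(3)[of "Suc n" t] that by auto
  next
    assume "t \<in> q ` {1..n}"
    then show ?thesis using Suc.prems(4)[of _ "Suc n"] that by fastforce
  qed
  ultimately have "itree (insert (q (Suc n)) ?S)"
    using itree.leaf[of ?S "q n" "q (Suc n)"] IH notin walk_adj[OF Suc.prems(1), of n] by blast
  moreover have "finite ?S" using IH itree_subset finite_verts finite_subset by blast
  ultimately show ?case using eq IH notin by simp
qed

lemma geodesic_itree: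
  assumes "walk q n" "n \<le> \<delta> (q 0) (q n)"
  shows "itree (q ` {..n}) \<and> card (q ` {..n}) = Suc n"
proof -
  have ne: "q i \<noteq> q j \<and> (q i \<sim> q j \<longrightarrow> j = Suc i)" if "i < j" "j \<le> n" for i j
  proof -
    have "\<delta> (q i) (q j) = j - i" using geodesic_dist[OF assms] that by simp
    moreover have "q i \<in> verts G" using walk_in_verts[OF assms(1), of i] that by auto
    ultimately show ?thesis using dist_adj[of "q i" "q j"] that by force
  qed
  have "itree ({q 0} \<union> q ` {1..n}) \<and> card ({q 0} \<union> q ` {1..n}) = card {q 0} + n"
  proof (rule itree_path)
    show "itree {q 0}" using assms by (auto intro: itree.single simp: walk_def)
    show "walk q n" by fact
    show "i = 1 \<and> s = q 0" if "1 \<le> i" "i \<le> n" "s \<in> {q 0}" "s \<sim> q i" for i s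
      using ne[of 0 i] that by auto
    show "q i \<notin> {q 0}" if "1 \<le> i" "i \<le> n" for i using ne[of 0 i] that by auto
    show "q i \<noteq> q j \<and> (q i \<sim> q j \<longrightarrow> j = Suc i)" if "1 \<le> i" "i < j" "j \<le> n" for i j
      using ne that by blast
  qed simp
  moreover have "{0} \<union> {1..n} = {..n}" by auto
  then have "{q 0} \<union> q ` {1..n} = q ` {..n}" by (metis image_Un image_empty image_insert)
  ultimately show ?thesis by simp
qed

section \<open>Diameter and periphery\<close>

lemma dist_le_diam:
  assumes "u \<in> verts G" "v \<in> verts G" shows "\<delta> u v \<le> diam"
proof -
  have "finite ((\<lambda>(u, v). \<delta> u v) ` (verts G \<times> verts G))" by simp
  moreover have "{\<delta> u v |u v. u \<in> verts G \<and> v \<in> verts G} = (\<lambda>(u, v). \<delta> u v) ` (verts G \<times> verts G)"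
    by auto
  ultimately show ?thesis unfolding graph_diameter_def using assms by (auto intro!: Max_ge)
qed

lemma verts_nonempty: "verts G \<noteq> {}"
  using symmetric_connected_imp_strongly_connected[OF sym_arcs conn] by (auto simp: strongly_connected_def)

lemma diametral_pair:
  obtains u v where "u \<in> verts G" "v \<in> verts G" "\<delta> u v = diam"
proof -
  have eq: "{\<delta> u v |u v. u \<in> verts G \<and> v \<in> verts G} = (\<lambda>(u, v). \<delta> u v) ` (verts G \<times> verts G)"
    by auto
  have "diam \<in> (\<lambda>(u, v). \<delta> u v) ` (verts G \<times> verts G)"
    unfolding graph_diameter_def eq by (rule Max_in) (use verts_nonempty in auto)
  then show ?thesis using that by auto
qed

lemma peripheryI:
  assumes "u \<in> verts G" "v \<in> verts G" "\<delta> u v = diam" shows "u \<in> periphery G"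
proof -
  have "Max {\<delta> u w |w. w \<in> verts G} = diam"
  proof (rule Max_eqI)
    have "{\<delta> u w |w. w \<in> verts G} = \<delta> u ` verts G" by auto
    then show "finite {\<delta> u w |w. w \<in> verts G}" by simp
  qed (use assms dist_le_diam in force)+
  then show ?thesis using assms by (simp add: periphery_def eccentricity_def)
qed

text \<open>The last alternative holds because a peripheral vertex has distance 0 from the
  periphery.\<close>

lemma farthest_from_periphery:
  obtains x where "x \<in> verts G" "\<And>y. y \<in> periphery G \<Longrightarrow> max_dist_periphery G \<le> \<delta> x y"
    "max_dist_periphery G = 0 \<or> x \<notin> periphery G"
proof -
  let ?P = "periphery G"
  have P: "?P \<subseteq> verts G" "finite ?P" by (auto simp: periphery_def)
  have im: "{\<delta> x y |y. y \<in> ?P} = \<delta> x ` ?P" for x by auto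
  have im': "{dist_to_set G x ?P |x. x \<in> verts G} = (\<lambda>x. dist_to_set G x ?P) ` verts G" by auto
  have "max_dist_periphery G \<in> (\<lambda>x. dist_to_set G x ?P) ` verts G"
    unfolding max_dist_periphery_def im' by (rule Max_in) (use verts_nonempty in auto)
  then obtain x where x: "x \<in> verts G" "max_dist_periphery G = dist_to_set G x ?P" by auto
  have le: "max_dist_periphery G \<le> \<delta> x y" if "y \<in> ?P" for y
    unfolding x(2) dist_to_set_def im using that P by auto
  then have "x \<in> ?P \<Longrightarrow> max_dist_periphery G = 0" using x(1) by fastforce
  then show ?thesis using that x(1) le by blast
qed

end

section \<open>Shortest cycles\<close>

text \<open>The cycle is traversed periodically, with period \<open>g\<close>.\<close>

locale shortest_cycle = connected_graph +
  fixes c :: "int \<Rightarrow> 'a" and g :: nat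
  assumes g3: "3 \<le> g"
    and c_eq: "\<And>i j. c i = c j \<longleftrightarrow> int g dvd i - j"
    and c_adj: "\<And>i. c i \<rightarrow>\<^bsub>G\<^esub> c (i + 1)"
    and shortest: "\<And>h n. circuit G h n \<Longrightarrow> g \<le> n"
begin

abbreviation C where "C \<equiv> range c"

lemma c_verts [simp]: "c i \<in> verts G"
  using c_adj adj_in_verts by blast

lemma C_eq: "C = (\<lambda>k. c (i + int k)) ` {..<g}"
proof -
  have "c j \<in> (\<lambda>k. c (i + int k)) ` {..<g}" for j
  proof
    have "int (nat ((j - i) mod int g)) = (j - i) mod int g" using g3 by simp
    moreover have "int g dvd j - i - (j - i) mod int g" by (rule dvd_minus_mod)
    ultimately show "c j = c (i + int (nat ((j - i) mod int g)))" by (simp add: c_eq algebra_simps)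
    have "(j - i) mod int g < int g" using g3 by simp
    then show "nat ((j - i) mod int g) \<in> {..<g}" using g3 by (simp add: nat_less_iff)
  qed
  then show ?thesis by auto
qed

lemma C_at: assumes "w \<in> C" obtains k where "k < g" "w = c (i + int k)"
  using assms C_eq[of i] by auto

lemma inj_c: "inj_on (\<lambda>k. c (i + int k)) {..<g}"
proof (rule inj_onI)
  fix x y assume "x \<in> {..<g}" "y \<in> {..<g}" "c (i + int x) = c (i + int y)"
  then have "int g dvd int x - int y" "\<bar>int x - int y\<bar> < int g" by (auto simp: c_eq)
  then show "x = y" using zdvd_imp_le[of "int g" "\<bar>int x - int y\<bar>"] by fastforce
qed

lemma finite_C [simp]: "finite C" using C_eq[of 0] by simp

lemma card_C: "card C = g"
  using C_eq[of 0] card_image[OF inj_c[of 0]] by simp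

lemma walk_c: "walk (\<lambda>k. c (i + int k)) n"
proof -
  have "c (i + int k) \<sim> c (i + int (Suc k))" for k
    using c_adj[of "i + int k"] by (simp add: algebra_simps)
  then show ?thesis by (simp add: walk_def)
qed

lemma no_triangle:
  assumes "a \<sim> b" "b \<sim> d" "d \<sim> a" shows "g = 3"
proof -
  have "i < 3 \<longleftrightarrow> i = 0 \<or> i = 1 \<or> i = 2" for i :: nat by auto
  moreover have "{..<3} = {0, 1, 2::nat}" by auto
  moreover have "a \<noteq> b" "b \<noteq> d" "d \<noteq> a" using assms adj_irrefl by auto
  ultimately have "circuit G (\<lambda>i. [a, b, d] ! i) 3"
    using assms by (simp add: circuit_def)
  then show ?thesis using shortest g3 le_antisym by blast
qed

lemma no_square:
  assumes "a \<sim> x" "x \<sim> b" "b \<sim> y" "y \<sim> a" "a \<noteq> b" "x \<noteq> y" shows "g \<le> 4"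
proof -
  have "i < 4 \<longleftrightarrow> i = 0 \<or> i = 1 \<or> i = 2 \<or> i = 3" for i :: nat by auto
  moreover have "{..<4} = {0, 1, 2, 3::nat}" by auto
  moreover have "a \<noteq> x" "x \<noteq> b" "b \<noteq> y" "y \<noteq> a" using assms adj_irrefl by auto
  ultimately have "circuit G (\<lambda>i. [a, x, b, y] ! i) 4"
    using assms by (simp add: circuit_def)
  then show ?thesis using shortest by blast
qed

text \<open>The ear \<open>q\<close> and the arc of length \<open>e\<close> between its ends form a
  circuit of length \<open>n + e\<close>. The bound \<open>2 \<le> e\<close> keeps this length at
  least 3 even if the ear is a single edge.\<close>

lemma ear_circuit:
  assumes q: "walk q n" "q 0 = c i" "q n = c (i + int e)" "n \<le> \<delta> (q 0) (q n)"
    and off: "\<And>m. 0 < m \<Longrightarrow> m < n \<Longrightarrow> q m \<notin> C"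
    and "1 \<le> n" "2 \<le> e" "e < g"
  shows "g \<le> n + e"
proof -
  \<comment> \<open>First along \<open>q\<close>, then back along the arc towards
    \<open>c i = h 0\<close>, stopping one step before it.\<close>
  define h where "h t = (if t \<le> n then q t else c (i + int e - int (t - n)))" for t
  have h_arc: "h t = c (i + int e - int (t - n))" if "n \<le> t" for t
    using that q(3) by (auto simp: h_def)
  have arc_ne: "c (i + int e - int s) \<noteq> c (i + int e - int t)" if "s < t" "t \<le> e" for s t
  proof
    assume "c (i + int e - int s) = c (i + int e - int t)"
    then have "int g dvd int t - int s" by (simp add: c_eq)
    then show False using that \<open>e < g\<close> zdvd_imp_le[of "int g" "int t - int s"] by simp
  qed
  have step: "h t \<sim> h (Suc t)" if "Suc t < n + e" for t
  proof (cases "t < n")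
    case True
    then show ?thesis using walk_adj[OF q(1)] by (simp add: h_def)
  next
    case False
    then have "c (i + int e - int (Suc t - n)) \<sim> c (i + int e - int (t - n))"
      using c_adj[of "i + int e - int (Suc t - n)"] by (simp add: Suc_diff_le algebra_simps)
    then show ?thesis using False h_arc adj_sym by simp
  qed
  have last: "h (n + e - 1) \<sim> h 0"
    using h_arc[of "n + e - 1"] adj_sym[OF c_adj[of i]] q(2) \<open>2 \<le> e\<close> \<open>1 \<le> n\<close> by (simp add: h_def of_nat_diff)
  have adj: "h t \<sim> h (Suc t mod (n + e))" if "t < n + e" for t
  proof (cases "Suc t = n + e")
    case True
    then have "t = n + e - 1" by simp
    then show ?thesis using last True by simp
  next
    case False
    then show ?thesis using that step by simp
  qed
  have ne: "h s \<noteq> h t" if "s < t" "t < n + e" for s t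
  proof -
    consider "t \<le> n" | "n \<le> s" | "s = 0" "n < t" | "0 < s" "s < n" "n < t" using that by linarith
    then show ?thesis
    proof cases
      case 1
      then have "\<delta> (q s) (q t) = t - s" "q s \<in> verts G"
        using geodesic_dist[OF q(1,4)] walk_in_verts[OF q(1)] that by auto
      then show ?thesis using 1 that by (auto simp: h_def)
    next
      case 2
      then show ?thesis using arc_ne[of "s - n" "t - n"] that h_arc by simp
    next
      case 3
      then have "h s = c (i + int e - int e)" using q(2) by (simp add: h_def)
      then show ?thesis using arc_ne[of "t - n" e] that 3 h_arc[of t] by (metis add_less_imp_less_left le_add_diff_inverse less_imp_le order_refl)
    next
      case 4
      then show ?thesis using off[of s] by (auto simp: h_def)
    qed
  qed
  then have "inj_on h {..<n + e}" by (intro linorder_inj_onI) auto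
  then have "circuit G h (n + e)" using adj \<open>1 \<le> n\<close> \<open>2 \<le> e\<close> by (simp add: circuit_def)
  then show ?thesis by (rule shortest)
qed

text \<open>The signed \<open>e\<close> is a displacement along the cycle. If a geodesic meets
  \<open>C\<close> in its interior, it splits and the displacements add. Otherwise it is an ear, and
  by \<open>ear_circuit\<close> one of the two arcs between its ends is no longer than it.\<close>

lemma isometric: "\<exists>e. \<bar>e\<bar> \<le> int (\<delta> (c i) (c j)) \<and> c j = c (i + e)"
proof (induction "\<delta> (c i) (c j)" arbitrary: i j rule: less_induct)
  case less
  let ?n = "\<delta> (c i) (c j)"
  obtain q where q: "q 0 = c i" "q ?n = c j" "walk q ?n" using geodesic by (metis c_verts)
  show ?case
  proof (cases "\<exists>m. 0 < m \<and> m < ?n \<and> q m \<in> C")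
    case True
    then obtain m k where m: "0 < m" "m < ?n" "q m = c k" by auto
    have d: "\<delta> (c i) (c k) = m" "\<delta> (c k) (c j) = ?n - m"
      using geodesic_dist[OF q(3), of 0 m] geodesic_dist[OF q(3), of m ?n] q m by auto
    obtain e1 where e1: "\<bar>e1\<bar> \<le> int m" "c k = c (i + e1)" using less[of i k] d m by auto
    have "\<delta> (c k) (c j) < ?n" using d m by simp
    then obtain e2 where e2: "\<bar>e2\<bar> \<le> int (\<delta> (c k) (c j))" "c j = c (k + e2)" using less by blast
    have "int g dvd (k - (i + e1)) + (j - (k + e2))" using e1 e2 c_eq dvd_add by blast
    then have "c j = c (i + (e1 + e2))" by (simp add: c_eq algebra_simps)
    moreover have "\<bar>e1 + e2\<bar> \<le> int ?n" using e1 e2 m d by linarith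
    ultimately show ?thesis by blast
  next
    case False
    obtain k where k: "k < g" "c j = c (i + int k)" using C_at[of "c j" i] by blast
    show ?thesis
    proof (cases "k \<le> ?n \<or> k = 0")
      case True
      then show ?thesis using k by (intro exI[of _ "int k"]) auto
    next
      case kn: False
      have "c i \<noteq> c j"
      proof
        assume "c i = c j"
        then have "int g dvd int k" using k(2) by (simp add: c_eq)
        then show False using kn k(1) zdvd_imp_le[of "int g" "int k"] by simp
      qed
      then have n1: "1 \<le> ?n" using dist_eq_0[of "c i" "c j"] by simp
      have *: "g \<le> ?n + k"
      proof (rule ear_circuit[OF q(3,1)])
        show "q m \<notin> C" if "0 < m" "m < ?n" for m using False that by blast
      qed (use q k n1 kn in auto)
      \<comment> \<open>The length of the complementary arc, which is traversed backwards.\<close>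
      define l where "l = g - k"
      have l: "l \<le> ?n" using * by (simp add: l_def)
      have "int g dvd (j - (i + int k)) + int g" using k(2) by (simp add: c_eq)
      moreover have "(j - (i + int k)) + int g = j - (i - int l)" using k(1) by (simp add: l_def of_nat_diff)
      ultimately have "c j = c (i - int l)" by (simp add: c_eq)
      then show ?thesis using l by (intro exI[of _ "- int l"]) simp
    qed
  qed
qed

text \<open>A displacement shorter than \<open>e\<close> would differ from \<open>e\<close> by a
  multiple of \<open>g\<close> strictly between 0 and \<open>g\<close>.\<close>

lemma isometric_half:
  assumes "2 * e \<le> g" shows "\<delta> (c i) (c (i + int e)) = e"
proof (rule antisym)
  show "\<delta> (c i) (c (i + int e)) \<le> e"
    using walk_dist_le[OF walk_c[of i e], of 0 e] by simp
  obtain l where l: "\<bar>l\<bar> \<le> int (\<delta> (c i) (c (i + int e)))" "int g dvd int e - l"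
    using isometric[of i "i + int e"] by (auto simp: c_eq)
  show "e \<le> \<delta> (c i) (c (i + int e))"
  proof (rule ccontr)
    assume "\<not> e \<le> \<delta> (c i) (c (i + int e))"
    then have "0 < int e - l" "int e - l < int g" using l(1) assms by linarith+
    then show False using zdvd_imp_le[OF l(2)] by simp
  qed
qed

lemma arc_dist: "i \<le> j \<Longrightarrow> \<delta> (c i) (c j) \<le> nat (j - i)"
  using walk_dist_le[OF walk_c[of i "nat (j - i)"], of 0 "nat (j - i)"] by simp

text \<open>Three vertices cut the cycle into arcs of total length \<open>g\<close>, each at least
  as long as the distance of its ends.\<close>

lemma cycle_triangle:
  assumes "a \<in> C" "b \<in> C" "d \<in> C"
  shows "\<delta> a b + \<delta> b d + \<delta> a d \<le> g"
proof -
  have *: "\<delta> (c i) (c (i + int j)) + \<delta> (c (i + int j)) (c (i + int k)) + \<delta> (c i) (c (i + int k)) \<le> g"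
    if "j \<le> k" "k < g" for i j k
  proof -
    have "c i = c (i + int g)" by (simp add: c_eq)
    then have "\<delta> (c (i + int k)) (c i) \<le> g - k"
      using arc_dist[of "i + int k" "i + int g"] that by (simp add: nat_diff_distrib)
    then show ?thesis
      using arc_dist[of i "i + int j"] arc_dist[of "i + int j" "i + int k"] that dist_sym[of "c i" "c (i + int k)"]
      by (simp add: nat_diff_distrib)
  qed
  obtain i where i: "a = c i" using assms by auto
  obtain j where j: "j < g" "b = c (i + int j)" using C_at assms(2) by metis
  obtain k where k: "k < g" "d = c (i + int k)" using C_at assms(3) by metis
  show ?thesis
    using *[of j k i] *[of k j i] i j k dist_sym[of b d] by (cases "j \<le> k") auto
qed

text \<open>By \<open>isometric\<close>, adjacent vertices of \<open>C\<close> are consecutive on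
  it, so deleting one vertex leaves a chordless path.\<close>

lemma cycle_minus_vertex:
  assumes "y \<in> C" shows "itree (C - {y}) \<and> card (C - {y}) = g - 1"
proof -
  obtain s where s: "y = c s" using assms by auto
  define q where "q k = c (s + 1 + int k)" for k
  have inj: "inj_on q {..<g}" unfolding q_def by (rule inj_c)
  \<comment> \<open>The bound \<open>j \<le> g - 2\<close> excludes wrapping around: for
    \<open>\<bar>e\<bar> \<le> 1\<close> the number \<open>j - i - e\<close> is less than
    \<open>g\<close>, hence not a positive multiple of it.\<close>
  have ne: "q i \<noteq> q j \<and> (q i \<sim> q j \<longrightarrow> j = Suc i)" if "i < j" "j \<le> g - 2" for i j
  proof -
    have "j = Suc i" if "\<delta> (q i) (q j) \<le> 1"
    proof -
      obtain e where "\<bar>e\<bar> \<le> int (\<delta> (q i) (q j))" and q: "q j = c (s + 1 + int i + e)"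
        using isometric[of "s + 1 + int i" "s + 1 + int j"] unfolding q_def by blast
      then have e: "\<bar>e\<bar> \<le> 1" "int g dvd int j - int i - e"
        using that by (simp_all add: q_def c_eq algebra_simps)
      have "\<not> 0 < int j - int i - e"
      proof
        assume "0 < int j - int i - e"
        then have "int g \<le> int j - int i - e" using zdvd_imp_le[OF e(2)] by blast
        then show False using e(1) \<open>i < j\<close> \<open>j \<le> g - 2\<close> g3 by linarith
      qed
      then show ?thesis using e(1) \<open>i < j\<close> by linarith
    qed
    moreover have "q i \<noteq> q j" using inj_on_eq_iff[OF inj, of i j] that g3 by auto
    ultimately show ?thesis using dist_adj by blast
  qed
  have "itree ({q 0} \<union> q ` {1..g - 2}) \<and> card ({q 0} \<union> q ` {1..g - 2}) = card {q 0} + (g - 2)"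
  proof (rule itree_path)
    show "itree {q 0}" by (auto intro: itree.single simp: q_def)
    show "walk q (g - 2)" unfolding q_def by (rule walk_c)
    show "i = 1 \<and> v = q 0" if "1 \<le> i" "i \<le> g - 2" "v \<in> {q 0}" "v \<sim> q i" for i v
      using ne[of 0 i] that by auto
    show "q i \<notin> {q 0}" if "1 \<le> i" "i \<le> g - 2" for i using ne[of 0 i] that by auto
  qed (use ne in auto)
  moreover have "{q 0} \<union> q ` {1..g - 2} = C - {y}"
  proof -
    have "{..<g} = insert (g - 1) ({0} \<union> {1..g - 2})" using g3 by auto
    then have "C = insert (q (g - 1)) ({q 0} \<union> q ` {1..g - 2})"
      using C_eq[of "s + 1"] by (simp add: q_def image_Un)
    moreover have "q (g - 1) = y" using g3 by (simp add: q_def s c_eq of_nat_diff)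
    moreover have "q (g - 1) \<notin> {q 0} \<union> q ` {1..g - 2}"
    proof
      assume "q (g - 1) \<in> {q 0} \<union> q ` {1..g - 2}"
      then obtain k where "k \<le> g - 2" "q (g - 1) = q k" by auto
      moreover from this have "k < g" "g - 1 \<noteq> k" using g3 by linarith+
      ultimately show False using inj_on_eq_iff[OF inj, of "g - 1" k] by simp
    qed
    ultimately show ?thesis by (metis Diff_insert_absorb)
  qed
  ultimately show ?thesis using g3 by simp
qed

section \<open>Distance to the cycle and rays\<close>

abbreviation L where "L w \<equiv> dist_to_set G w C"

lemma L_le: "y \<in> C \<Longrightarrow> L w \<le> \<delta> w y"
proof -
  have "{\<delta> w y |y. y \<in> C} = \<delta> w ` C" by auto
  then show "y \<in> C \<Longrightarrow> L w \<le> \<delta> w y" by (simp add: dist_to_set_def)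
qed

lemma L_attained: obtains y where "y \<in> C" "L w = \<delta> w y"
proof -
  have "Min (\<delta> w ` C) \<in> \<delta> w ` C" by (rule Min_in) auto
  moreover have "L w = Min (\<delta> w ` C)" by (simp add: dist_to_set_def setcompr_eq_image)
  ultimately have "L w \<in> \<delta> w ` C" by simp
  then show ?thesis by (rule imageE) (use that in blast)
qed

lemma C_subset: "C \<subseteq> verts G" by auto

lemma L_0:
  assumes "w \<in> verts G" shows "L w = 0 \<longleftrightarrow> w \<in> C"
proof
  assume "L w = 0"
  moreover obtain y where "y \<in> C" "L w = \<delta> w y" using L_attained .
  ultimately show "w \<in> C" using dist_eq_0[of w y] assms C_subset by auto
next
  assume "w \<in> C"
  then show "L w = 0" using L_le[of w w] assms by simp
qed

lemma L_lipschitz: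
  assumes "a \<in> verts G" "b \<in> verts G" shows "L a \<le> \<delta> a b + L b"
proof -
  obtain y where y: "y \<in> C" "L b = \<delta> b y" using L_attained .
  then have "\<delta> a y \<le> \<delta> a b + \<delta> b y" using dist_triangle assms C_subset by blast
  then show ?thesis using L_le[of y a] y by simp
qed

lemma L_adj: "a \<sim> b \<Longrightarrow> L a \<le> L b + 1"
  using L_lipschitz[of a b] dist_adj[of a b] adj_in_verts[of a b] by simp

text \<open>Rays run outwards: \<open>p 0\<close> is the foot on the cycle, and the condition on
  \<open>L\<close> makes the ray a shortest path to \<open>C\<close> read backwards.\<close>

definition ray :: "(nat \<Rightarrow> 'a) \<Rightarrow> nat \<Rightarrow> bool" where
  "ray p n \<longleftrightarrow> walk p n \<and> p 0 \<in> C \<and> (\<forall>i\<le>n. L (p i) = i)"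

lemma ray_to:
  assumes "w \<in> verts G" obtains p where "ray p (L w)" "p (L w) = w"
proof -
  obtain y where y: "y \<in> C" "L w = \<delta> w y" using L_attained .
  have yv: "y \<in> verts G" using y C_subset by blast
  have n: "\<delta> y w = L w" using y dist_sym assms yv by simp
  obtain p where p: "p 0 = y" "p (L w) = w" "walk p (L w)" using geodesic[OF yv assms] unfolding n by blast
  have "L (p i) = i" if "i \<le> L w" for i
  proof -
    have pi: "p i \<in> verts G" using walk_in_verts[OF p(3) that] .
    have "L (p i) \<le> \<delta> (p i) y" by (rule L_le[OF y(1)])
    also have "\<dots> = \<delta> y (p i)" by (rule dist_sym[OF pi yv])
    also have "\<dots> \<le> i" using walk_dist_le[OF p(3), of 0 i] that p by simp
    finally have "L (p i) \<le> i" .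
    moreover have "\<delta> w (p i) \<le> L w - i"
      using walk_dist_le[OF p(3) that order_refl] p(2) dist_sym[OF pi assms] by simp
    ultimately show ?thesis using L_lipschitz[OF assms pi] that by linarith
  qed
  then show ?thesis using that[of p] p y by (auto simp: ray_def)
qed

lemma rayD:
  assumes "ray p n"
  shows "walk p n" "p 0 \<in> C" "\<And>i. i \<le> n \<Longrightarrow> L (p i) = i" "\<And>i. i \<le> n \<Longrightarrow> p i \<in> verts G"
    "\<And>i. 1 \<le> i \<Longrightarrow> i \<le> n \<Longrightarrow> p i \<notin> C" "\<And>i. i < n \<Longrightarrow> p i \<sim> p (Suc i)"
proof -
  show w: "walk p n" and "p 0 \<in> C" and L: "\<And>i. i \<le> n \<Longrightarrow> L (p i) = i" using assms by (auto simp: ray_def)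
  show v: "\<And>i. i \<le> n \<Longrightarrow> p i \<in> verts G" using walk_in_verts[OF w] .
  show "p i \<notin> C" if "1 \<le> i" "i \<le> n" for i using L[OF that(2)] L_0[OF v[OF that(2)]] that(1) by simp
  show "\<And>i. i < n \<Longrightarrow> p i \<sim> p (Suc i)" using walk_adj[OF w] .
qed

lemma ray_chordless:
  assumes "ray p n" "i < j" "j \<le> n" shows "p i \<noteq> p j \<and> (p i \<sim> p j \<longrightarrow> j = Suc i)"
proof -
  have "L (p i) = i" "L (p j) = j" using rayD(3)[OF assms(1)] assms by auto
  then show ?thesis using assms(2) L_adj[of "p j" "p i"] adj_sym[of "p i" "p j"] by auto
qed

text \<open>Both indices start at 1, so merely sharing a foot on \<open>C\<close> does not count as
  touching.\<close>

definition touching :: "(nat \<Rightarrow> 'a) \<Rightarrow> nat \<Rightarrow> (nat \<Rightarrow> 'a) \<Rightarrow> nat \<Rightarrow> bool" where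
  "touching p n w m \<longleftrightarrow> (\<exists>i\<in>{1..n}. \<exists>j\<in>{1..m}. p i = w j \<or> p i \<sim> w j)"

lemma not_touchingD:
  "\<not> touching p n w m \<Longrightarrow> s \<in> p ` {1..n} \<Longrightarrow> 1 \<le> j \<Longrightarrow> j \<le> m \<Longrightarrow> s \<noteq> w j \<and> \<not> s \<sim> w j"
  by (auto simp: touching_def)

end

section \<open>Girth at least five: attaching rays to the cycle\<close>

locale long_shortest_cycle = shortest_cycle +
  assumes g5: "5 \<le> g"
begin

lemma common_neighbour: "a \<sim> x \<Longrightarrow> b \<sim> x \<Longrightarrow> a \<sim> y \<Longrightarrow> b \<sim> y \<Longrightarrow> a = b \<or> x = y"
  using no_square[of a x b y] adj_sym[of b x] adj_sym[of a y] g5 by auto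

text \<open>Two neighbours of \<open>w\<close> on the isometric cycle have displacement at most 2.
  Displacement 1 closes a triangle with \<open>w\<close>, displacement 2 a square through the vertex
  of \<open>C\<close> between them.\<close>

lemma cycle_neighbour_unique:
  assumes "w \<notin> C" "a \<in> C" "b \<in> C" "a \<sim> w" "b \<sim> w" shows "a = b"
proof (rule ccontr)
  assume "a \<noteq> b"
  obtain i j where ij: "a = c i" "b = c j" using assms by auto
  have "\<delta> a b \<le> 2"
    using dist_triangle[of a w b] dist_adj[OF assms(4)] dist_adj[OF adj_sym[OF assms(5)]]
      adj_in_verts[OF assms(4)] adj_in_verts[OF assms(5)] by simp
  then obtain e where e: "\<bar>e\<bar> \<le> 2" "b = c (i + e)" using isometric[of i j] ij by force
  consider "e = 0" | "e = 1" | "e = - 1" | "e = 2" | "e = - 2" using e(1) by linarith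
  then show False
  proof cases
    case 1 then show ?thesis using \<open>a \<noteq> b\<close> ij e by simp
  next
    case 2 then show ?thesis using no_triangle[of a b w] c_adj[of i] ij e assms adj_sym g5 by simp
  next
    case 3 then show ?thesis using no_triangle[of b a w] c_adj[of "i - 1"] ij e assms adj_sym g5 by simp
  next
    case 4
    then have "b \<sim> c (i + 1)" using c_adj[of "i + 1"] e adj_sym by (simp add: algebra_simps)
    then show ?thesis
      using common_neighbour[of a w b "c (i + 1)"] \<open>a \<noteq> b\<close> c_adj[of i] ij assms by auto
  next
    case 5
    then have "b \<sim> c (i - 1)" using c_adj[of "i - 2"] e by (simp add: algebra_simps)
    then show ?thesis
      using common_neighbour[of a w b "c (i - 1)"] \<open>a \<noteq> b\<close> adj_sym[OF c_adj[of "i - 1"]] ij assms by auto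
  qed
qed

lemma ray_cycle_neighbour:
  assumes "ray p n" "1 \<le> i" "i \<le> n" "s \<in> C" "s \<sim> p i" shows "i = 1 \<and> s = p 0"
proof -
  have "L s = 0" using L_0[of s] assms(4) C_subset by auto
  then have "i = 1" using L_adj[OF adj_sym[OF assms(5)]] rayD(3)[OF assms(1,3)] assms(2) by simp
  moreover have "p 0 \<sim> p 1" "p 0 \<in> C" "p 1 \<notin> C"
    using rayD(2)[OF assms(1)] rayD(5)[OF assms(1), of 1] rayD(6)[OF assms(1), of 0] assms(2,3) by auto
  ultimately show ?thesis using cycle_neighbour_unique[of "p 1" s "p 0"] assms(4,5) by simp
qed

text \<open>Only vertices of \<open>S\<close> off the cycle need a hypothesis: by
  \<open>ray_cycle_neighbour\<close> the sole edge from \<open>C\<close> to the rest of the ray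
  starts at the foot.\<close>

lemma attach_ray:
  assumes "itree S" "ray p n" "p 0 \<in> S"
    and "\<And>s i. s \<in> S \<Longrightarrow> s \<notin> C \<Longrightarrow> 1 \<le> i \<Longrightarrow> i \<le> n \<Longrightarrow> s \<noteq> p i \<and> \<not> s \<sim> p i"
  shows "itree (S \<union> p ` {1..n}) \<and> card (S \<union> p ` {1..n}) = card S + n"
proof (rule itree_path)
  show "p i \<notin> S" if "1 \<le> i" "i \<le> n" for i using assms(4) rayD(5)[OF assms(2)] that by blast
  show "i = 1 \<and> s = p 0" if "1 \<le> i" "i \<le> n" "s \<in> S" "s \<sim> p i" for i s
    using assms(4)[OF that(3) _ that(1,2)] ray_cycle_neighbour[OF assms(2) that(1,2) _ that(4)] that(4) by metis
qed (use assms rayD ray_chordless in auto)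

lemma cycle_avoiding:
  assumes "card A \<le> 4" "finite A" obtains y where "y \<in> C" "y \<notin> A"
proof -
  have "\<not> C \<subseteq> A" using card_mono[of A C] assms card_C g5 by auto
  then show ?thesis using that by blast
qed

lemma three_rays:
  assumes r: "ray p n" "ray q m" "ray r k"
    and nt: "\<not> touching p n q m" "\<not> touching p n r k" "\<not> touching q m r k"
  shows "g - 1 + (n + m + k) \<le> induced_tree_number G"
proof -
  obtain y where y: "y \<in> C" "y \<notin> {p 0, q 0, r 0}"
  proof (rule cycle_avoiding)
    show "card {p 0, q 0, r 0} \<le> 4" by (simp add: card_insert_if)
  qed auto
  let ?S = "C - {y}"
  have S: "itree ?S" "card ?S = g - 1" using cycle_minus_vertex[OF y(1)] by auto
  have "itree (?S \<union> p ` {1..n}) \<and> card (?S \<union> p ` {1..n}) = card ?S + n"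
    by (rule attach_ray) (use S r y rayD(2) in auto)
  then have 1: "itree (?S \<union> p ` {1..n})" "card (?S \<union> p ` {1..n}) = g - 1 + n" using S by auto
  have "itree (?S \<union> p ` {1..n} \<union> q ` {1..m}) \<and> card (?S \<union> p ` {1..n} \<union> q ` {1..m}) = card (?S \<union> p ` {1..n}) + m"
  proof (rule attach_ray)
    show "q 0 \<in> ?S \<union> p ` {1..n}" using y rayD(2)[OF r(2)] by auto
    show "s \<noteq> q i \<and> \<not> s \<sim> q i" if "s \<in> ?S \<union> p ` {1..n}" "s \<notin> C" "1 \<le> i" "i \<le> m" for s i
      using not_touchingD[OF nt(1)] that by blast
  qed (use 1 r in auto)
  then have 2: "itree (?S \<union> p ` {1..n} \<union> q ` {1..m})" "card (?S \<union> p ` {1..n} \<union> q ` {1..m}) = g - 1 + n + m"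
    using 1 by auto
  have "itree (?S \<union> p ` {1..n} \<union> q ` {1..m} \<union> r ` {1..k}) \<and>
      card (?S \<union> p ` {1..n} \<union> q ` {1..m} \<union> r ` {1..k}) = card (?S \<union> p ` {1..n} \<union> q ` {1..m}) + k"
  proof (rule attach_ray)
    show "r 0 \<in> ?S \<union> p ` {1..n} \<union> q ` {1..m}" using y rayD(2)[OF r(3)] by auto
    show "s \<noteq> r i \<and> \<not> s \<sim> r i"
      if "s \<in> ?S \<union> p ` {1..n} \<union> q ` {1..m}" "s \<notin> C" "1 \<le> i" "i \<le> k" for s i
    proof -
      have "s \<in> p ` {1..n} \<union> q ` {1..m}" using that by auto
      then show ?thesis
        using not_touchingD[OF nt(2)] not_touchingD[OF nt(3)] that(3,4) by blast
    qed
  qed (use 2 r in auto)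
  then show ?thesis using itree_card_le[of "?S \<union> p ` {1..n} \<union> q ` {1..m} \<union> r ` {1..k}"] 2 by simp
qed

end

section \<open>The lower bound\<close>

context connected_graph
begin

lemma diam_bound: "diam + 1 \<le> induced_tree_number G"
proof -
  obtain u v where uv: "u \<in> verts G" "v \<in> verts G" "\<delta> u v = diam" by (rule diametral_pair)
  obtain q where q: "q 0 = u" "q diam = v" "walk q diam"
    using geodesic[OF uv(1,2)] unfolding uv(3) by blast
  then show ?thesis using geodesic_itree[OF q(3)] uv(3) itree_card_le[of "q ` {..diam}"] by simp
qed

lemma ex_shortest_cycle:
  assumes "undirected_cycle G p" shows "\<exists>c. shortest_cycle G c (girth G)"
proof -
  obtain h where h: "circuit G h (girth G)" using circuit_girth assms by blast
  let ?g = "girth G"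
  have g: "3 \<le> ?g" and inj: "inj_on h {..<?g}" and adj: "\<And>i. i < ?g \<Longrightarrow> h i \<sim> h (Suc i mod ?g)"
    using h by (auto simp: circuit_def)
  define c where "c i = h (nat (i mod int ?g))" for i :: int
  have lt: "nat (i mod int ?g) < ?g" for i using g by (simp add: nat_less_iff)
  have "c i = c j \<longleftrightarrow> int ?g dvd i - j" for i j
  proof -
    have "c i = c j \<longleftrightarrow> nat (i mod int ?g) = nat (j mod int ?g)"
      unfolding c_def using inj_on_eq_iff[OF inj] lt by simp
    also have "\<dots> \<longleftrightarrow> i mod int ?g = j mod int ?g"
      using g by (subst eq_nat_nat_iff) auto
    finally show ?thesis by (simp add: mod_eq_dvd_iff)
  qed
  moreover have "c i \<sim> c (i + 1)" for i
  proof -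
    have "int (Suc (nat (i mod int ?g)) mod ?g) = (i + 1) mod int ?g"
      using g by (simp add: zmod_int add.commute mod_add_right_eq)
    then have "Suc (nat (i mod int ?g)) mod ?g = nat ((i + 1) mod int ?g)" by linarith
    then show ?thesis using adj[OF lt[of i]] by (simp add: c_def)
  qed
  ultimately have "shortest_cycle G c ?g"
    using g girth_le_circuit by unfold_locales auto
  then show ?thesis by blast
qed

end

section \<open>Girth four\<close>

context shortest_cycle
begin

text \<open>A diametral path has \<open>D + 1\<close> vertices, and one more is found on a shortest
  path \<open>r\<close> from it to \<open>x\<close>. If \<open>r 1\<close> has only one neighbour on
  the diametral path, it is a leaf. Otherwise it replaces the vertex between two such neighbours,
  and \<open>r 2\<close> becomes the leaf.\<close>

lemma girth_four_bound:
  assumes "g = 4" "x \<in> verts G" "u \<in> verts G" "v \<in> verts G" "\<delta> u v = D" "2 \<le> D"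
    and far: "D \<le> \<delta> x u + 1" "D \<le> \<delta> x v + 1" and ecc: "\<And>z. z \<in> verts G \<Longrightarrow> \<delta> x z < D"
  shows "D + 2 \<le> induced_tree_number G"
proof (cases "D = 2")
  case True
  have ne: "c i \<noteq> c (i + 1)" "c i \<noteq> c (i + 2)" for i
    using assms(1) by (auto simp: c_eq dest: zdvd_imp_le)
  \<comment> \<open>For \<open>D = 2\<close>, \<open>x\<close> is adjacent to all other vertices, so
    an edge of the cycle avoiding \<open>x\<close> completes a triangle.\<close>
  have "x \<noteq> c 1 \<and> x \<noteq> c 2 \<or> x \<noteq> c 2 \<and> x \<noteq> c 3 \<or> x \<noteq> c 0 \<and> x \<noteq> c 1"
    using ne(1)[of 0] ne(1)[of 1] ne(1)[of 2] ne(2)[of 0] ne(2)[of 1] by auto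
  then have "\<exists>i\<in>{0, 1, 2}. x \<noteq> c i \<and> x \<noteq> c (i + 1)" by auto
  then obtain i where i: "x \<noteq> c i" "x \<noteq> c (i + 1)" by blast
  have "x \<sim> c i" "x \<sim> c (i + 1)"
    using ecc[of "c i"] ecc[of "c (i + 1)"] True dist_le_1[of x "c i"] dist_le_1[of x "c (i + 1)"] assms(2) i by auto
  then have "g = 3" using no_triangle[OF c_adj[of i] adj_sym] by blast
  then show ?thesis using assms(1) by simp
next
  case False
  then have D3: "3 \<le> D" using assms(6) by simp
  obtain p where p: "p 0 = u" "p D = v" "walk p D"
    using geodesic[OF assms(3,4)] unfolding assms(5) by blast
  have pv: "p i \<in> verts G" if "i \<le> D" for i using walk_in_verts[OF p(3) that] .
  have pd: "\<delta> (p i) (p j) = j - i" if "i \<le> j" "j \<le> D" for i j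
    using geodesic_dist[OF p(3) _ that] p assms(5) by simp
  define m where "m = Min ((\<lambda>i. \<delta> x (p i)) ` {..D})"
  have "m \<in> (\<lambda>i. \<delta> x (p i)) ` {..D}" unfolding m_def by (rule Min_in) auto
  then obtain k where k: "k \<le> D" "\<delta> x (p k) = m" by auto
  have m_le: "m \<le> \<delta> x (p i)" if "i \<le> D" for i unfolding m_def using that by (intro Min_le) auto
  \<comment> \<open>If \<open>x\<close> lay on the path, its distances to \<open>u\<close> and
    \<open>v\<close> would add up to \<open>D\<close>, which is less than
    \<open>2 * D - 2\<close>.\<close>
  have m1: "1 \<le> m"
  proof (rule ccontr)
    assume "\<not> 1 \<le> m"
    then have "x = p k" using k dist_eq_0[OF assms(2) pv[OF k(1)]] by simp
    then have "\<delta> x u = k" "\<delta> x v = D - k"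
      using pd[of 0 k] pd[of k D] k(1) p dist_sym[OF assms(3) pv[OF k(1)]] by auto
    then show False using far D3 k(1) by linarith
  qed
  have pkx: "\<delta> (p k) x = m" using k dist_sym[OF assms(2) pv[OF k(1)]] by simp
  then obtain r where r: "r 0 = p k" "r m = x" "walk r m"
    using geodesic[OF pv[OF k(1)] assms(2)] unfolding pkx by blast
  have rv: "r i \<in> verts G" if "i \<le> m" for i using walk_in_verts[OF r(3) that] .
  have rx: "\<delta> x (r i) \<le> m - i" if "i \<le> m" for i
    using walk_dist_le[OF r(3) that order_refl] r dist_sym[OF assms(2) rv[OF that]] by simp
  have step: "\<delta> x b \<le> \<delta> x a + 1" if "a \<sim> b" for a b
    using dist_triangle[of x a b] dist_adj[OF that] adj_in_verts[OF that] assms(2) by simp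
  have r1: "r 1 \<noteq> p i" if "i \<le> D" for i using m_le[OF that] rx[of 1] m1 by auto
  then have r1': "r 1 \<notin> p ` {..D}" by blast
  have kr: "p k \<sim> r 1" using walk_adj[OF r(3), of 0] m1 r by simp
  have P: "itree (p ` {..D})" "card (p ` {..D}) = Suc D"
    using geodesic_itree[OF p(3)] p assms(5) by auto
  show ?thesis
  proof (cases "\<forall>i\<le>D. p i \<sim> r 1 \<longrightarrow> p i = p k")
    case True
    have "itree (insert (r 1) (p ` {..D}))"
    proof (rule itree.leaf[OF P(1) _ kr r1'])
      show "p k \<in> p ` {..D}" using k(1) by blast
      show "t = p k" if "t \<in> p ` {..D}" "t \<sim> r 1" for t using that True by blast
    qed
    moreover have "card (insert (r 1) (p ` {..D})) = D + 2" using P(2) r1' by simp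
    ultimately show ?thesis using itree_card_le by metis
  next
    case False
    then obtain l where l: "l \<le> D" "p l \<sim> r 1" "l \<noteq> k" by auto
    define i j where "i = min k l" and "j = max k l"
    have ij: "i < j" "j \<le> D" "p i \<sim> r 1" "p j \<sim> r 1"
      using l k kr by (auto simp: i_def j_def min_def max_def)
    have "\<delta> (p i) (p j) \<le> 2"
      using dist_triangle[of "p i" "r 1" "p j"] dist_adj[OF ij(3)] dist_adj[OF adj_sym[OF ij(4)]]
        pv rv[of 1] m1 ij by simp
    then have "j = i + 1 \<or> j = i + 2" using pd[of i j] ij by auto
    moreover have "j \<noteq> i + 1"
      using no_triangle[of "p i" "p j" "r 1"] walk_adj[OF p(3), of i] ij adj_sym assms(1) by auto
    ultimately have j: "j = i + 2" by simp
    have "\<delta> x (p i) \<le> m" "\<delta> x (p j) \<le> m"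
      using step[OF adj_sym[OF ij(3)]] step[OF adj_sym[OF ij(4)]] rx[of 1] m1 by auto
    moreover have "\<delta> x u \<le> \<delta> x (p i) + i" "\<delta> x v \<le> \<delta> x (p j) + (D - j)"
      using dist_triangle[of x "p i" u] dist_triangle[of x "p j" v] pd[of 0 i] pd[of j D] p pv[of i] pv[of j] ij
        dist_sym[of "p i" u] assms(2-4) by auto
    \<comment> \<open>Adding the two estimates, with \<open>j = i + 2\<close>, gives
      \<open>D \<le> 2 * m\<close>, so \<open>r 2\<close> exists.\<close>
    ultimately have m2: "2 \<le> m" using far D3 ij j by linarith
    \<comment> \<open>The geodesic is rerouted through \<open>r 1\<close>, the other common
      neighbour of \<open>p i\<close> and \<open>p j\<close>.\<close>
    define p' where "p' = p(i + 1 := r 1)"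
    have "walk p' D" unfolding walk_def
    proof (intro conjI allI impI)
      show "p' 0 \<in> verts G" using p assms(3) by (simp add: p'_def)
      show "p' n \<sim> p' (Suc n)" if "n < D" for n
      proof -
        consider "n = i" | "n = i + 1" | "n \<noteq> i" "n \<noteq> i + 1" by blast
        then show ?thesis
        proof cases
          case 2
          then show ?thesis using adj_sym[OF ij(4)] j by (simp add: p'_def)
        qed (use ij walk_adj[OF p(3) that] in \<open>auto simp: p'_def\<close>)
      qed
    qed
    moreover have "p' 0 = u" "p' D = v" using p ij j by (auto simp: p'_def)
    ultimately have P': "itree (p' ` {..D})" "card (p' ` {..D}) = Suc D"
      using geodesic_itree[of p' D] assms(5) by auto
    \<comment> \<open>\<open>r 2\<close> is within \<open>m - 2\<close> of \<open>x\<close>, while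
      all vertices of \<open>p\<close> are at distance at least \<open>m\<close>.\<close>
    have far2: "\<not> p n \<sim> r 2" "r 2 \<noteq> p n" if "n \<le> D" for n
      using m_le[OF that] step[OF adj_sym, of "p n" "r 2"] rx[OF m2] m2 by auto
    have rr: "r 1 \<sim> r 2" using walk_adj[OF r(3), of 1] m2 by (simp add: numeral_2_eq_2)
    have sub: "p' ` {..D} \<subseteq> insert (r 1) (p ` {..D})" by (auto simp: p'_def)
    have "r 2 \<noteq> r 1" using rr adj_irrefl by metis
    moreover have "r 2 \<notin> p ` {..D}" using far2(2) by blast
    ultimately have r2: "r 2 \<notin> p' ` {..D}" using sub by blast
    have "itree (insert (r 2) (p' ` {..D}))"
    proof (rule itree.leaf[OF P'(1), of "r 1"])
      have "p' (i + 1) = r 1" by (simp add: p'_def)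
      then show "r 1 \<in> p' ` {..D}" using ij by (metis Suc_eq_plus1 Suc_leI atMost_iff image_eqI less_le_trans)
      show "r 2 \<notin> p' ` {..D}" by (rule r2)
      show "t = r 1" if "t \<in> p' ` {..D}" "t \<sim> r 2" for t using subsetD[OF sub that(1)] far2(1) that(2) by auto
    qed (rule rr)
    moreover have "card (insert (r 2) (p' ` {..D})) = D + 2"
    proof -
      show ?thesis using P'(2) r2 by simp
    qed
    ultimately show ?thesis using itree_card_le by metis
  qed
qed

end

section \<open>Girth at least five: touching rays and the final estimate\<close>

context long_shortest_cycle
begin

text \<open>The levels \<open>L\<close> of two neighbours of \<open>x\<close> differ by at most 2.
  Difference 1 yields a triangle, difference 2 a square through \<open>p (i + 1)\<close>.\<close>

lemma ray_neighbour_unique: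
  assumes "ray p n" "i < l" "l \<le> n" "p i \<sim> x" "p l \<sim> x" and off: "\<And>k. k \<le> n \<Longrightarrow> p k \<noteq> x"
  shows False
proof -
  have "l \<le> L x + 1" "L x \<le> i + 1"
    using L_adj[OF assms(5)] L_adj[OF adj_sym[OF assms(4)]] rayD(3)[OF assms(1)] assms(2,3) by auto
  then have "l = i + 1 \<or> l = i + 2" using assms(2) by auto
  moreover have st: "p i \<sim> p (i + 1)" using rayD(6)[OF assms(1), of i] assms(2,3) by simp
  moreover have "l \<noteq> i + 1" using no_triangle[OF st, of x] assms(4,5) adj_sym[OF assms(4)] g5 by auto
  moreover have "l \<noteq> i + 2"
  proof
    assume l: "l = i + 2"
    have "p (i + 1) \<sim> p l" using rayD(6)[OF assms(1), of "i + 1"] assms(3) l by simp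
    then have "p i = p l \<or> p (i + 1) = x"
      using common_neighbour[OF st adj_sym assms(4,5)] by blast
    then show False using off[of "i + 1"] ray_chordless[OF assms(1-3)] l assms(3) by auto
  qed
  ultimately show False by blast
qed

text \<open>Attaches only the outer part of a ray, from \<open>p j\<close> on, at a vertex
  \<open>z\<close> that need not be on the cycle.\<close>

lemma attach_tail:
  assumes "itree S" "z \<in> S" "ray p n" "1 \<le> j" "j \<le> n" "z \<sim> p j"
    and S: "\<And>s l. s \<in> S \<Longrightarrow> j \<le> l \<Longrightarrow> l \<le> n \<Longrightarrow> s \<noteq> p l \<and> (s \<sim> p l \<longrightarrow> l = j \<and> s = z)"
  shows "card S + (n - j + 1) \<le> induced_tree_number G"
proof -
  define q where "q t = (if t = 0 then z else p (j + t - 1))" for t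
  let ?k = "n - j + 1"
  have "itree (S \<union> q ` {1..?k}) \<and> card (S \<union> q ` {1..?k}) = card S + ?k"
  proof (rule itree_path)
    show "walk q ?k" unfolding walk_def
    proof (intro conjI allI impI)
      show "q 0 \<in> verts G" using itree_subset assms(1,2) by (auto simp: q_def)
      show "q t \<sim> q (Suc t)" if "t < ?k" for t
        using assms(6) rayD(6)[OF assms(3), of "j + t - 1"] that assms(4) by (auto simp: q_def)
    qed
    have ix: "j \<le> j + t - 1" "j + t - 1 \<le> n" if "1 \<le> t" "t \<le> ?k" for t
      using that assms(5) by linarith+
    show "q t \<notin> S" if "1 \<le> t" "t \<le> ?k" for t
      using S[OF _ ix[OF that]] that(1) by (auto simp: q_def)
    show "t = 1 \<and> s = q 0" if "1 \<le> t" "t \<le> ?k" "s \<in> S" "s \<sim> q t" for t s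
      using S[OF that(3) ix[OF that(1,2)]] that(1,4) by (auto simp: q_def)
    show "q s \<noteq> q t \<and> (q s \<sim> q t \<longrightarrow> t = Suc s)" if "1 \<le> s" "s < t" "t \<le> ?k" for s t
    proof -
      have "j + s - 1 < j + t - 1" using that by linarith
      then show ?thesis
        using ray_chordless[OF assms(3) _ ix(2), of "j + s - 1" t] that by (auto simp: q_def)
    qed
  qed (use assms in \<open>auto simp: q_def\<close>)
  then show ?thesis using itree_card_le by metis
qed

text \<open>
  Take the contact point \<open>w j\<close> on the second ray closest to its far end.  The part of that ray from
  \<open>w j\<close> on is attached to the first ray; but if \<open>w j\<close> is itself a neighbour of the cycle, this would
  close a second cycle, so instead the foot of the first ray is deleted and its outer part is
  attached to the second ray.
\<close>

lemma touching_rays: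
  assumes p: "ray p n" and w: "ray w m" and "touching p n w m"
  shows "g + \<delta> (p n) (w m) \<le> induced_tree_number G"
proof -
  define J where "J = {j \<in> {1..m}. \<exists>i\<in>{1..n}. p i = w j \<or> p i \<sim> w j}"
  define j where "j = Max J"
  have J: "finite J" "J \<noteq> {}" using assms(3) by (auto simp: J_def touching_def)
  then have "j \<in> J" unfolding j_def by (rule Max_in)
  then obtain i where i: "1 \<le> i" "i \<le> n" "p i = w j \<or> p i \<sim> w j" and j: "1 \<le> j" "j \<le> m"
    by (auto simp: J_def)
  have maxj: "l \<notin> J" if "j < l" for l using that Max_ge[OF J(1), of l] by (auto simp: j_def)
  have later: "p l \<noteq> w k \<and> \<not> p l \<sim> w k" if "1 \<le> l" "l \<le> n" "j < k" "k \<le> m" for k l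
    using maxj[OF that(3)] that j by (auto simp: J_def)
  show ?thesis
  proof (cases "\<exists>l\<in>{1..n}. p l = w j")
    \<comment> \<open>The rays share a vertex. Maximality of \<open>j\<close> makes it the far end
      of \<open>w\<close>, since its successor on \<open>w\<close> would be a later contact. Then
      the single ray \<open>p\<close> suffices, because
      \<open>\<delta> (p n) (w m) \<le> n - m\<close> and \<open>1 \<le> m\<close>.\<close>
    case True
    then obtain l where l: "1 \<le> l" "l \<le> n" "p l = w j" by auto
    have lj: "l = j" using rayD(3)[OF p l(2)] rayD(3)[OF w j(2)] l(3) by simp
    have "j = m"
    proof (rule ccontr)
      assume "j \<noteq> m"
      then have "p l \<sim> w (Suc j)" using rayD(6)[OF w, of j] j l(3) by simp
      then show False using later[of l "Suc j"] l j \<open>j \<noteq> m\<close> by simp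
    qed
    then have "\<delta> (p n) (w m) \<le> n - m"
      using walk_dist_le[OF rayD(1)[OF p] l(2) order_refl] l(3) lj
        dist_sym[OF rayD(4)[OF p l(2)] rayD(4)[OF p order_refl]] by simp
    moreover have "ray p 0" using p by (simp add: ray_def walk_def)
    then have "g - 1 + (n + 0 + 0) \<le> induced_tree_number G"
      using three_rays[OF p, of p 0 p 0] by (simp add: touching_def)
    ultimately show ?thesis using j \<open>j = m\<close> lj l(2) g5 by linarith
  next
    case False
    have ne: "p l \<noteq> w k" if "1 \<le> l" "l \<le> n" "j \<le> k" "k \<le> m" for k l
      using False later that by (cases "j = k") auto
    have ij: "p i \<sim> w j" using i False by auto
    have wv: "w j \<notin> C" using rayD(5)[OF w j] .
    have off: "p k \<noteq> w j" if "k \<le> n" for k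
      using ne[of k j] that j rayD(2)[OF p] wv by (cases "k = 0") auto
    have uniq: "l = i" if "l \<le> n" "p l \<sim> w j" for l
      using ray_neighbour_unique[OF p, of l i "w j"] ray_neighbour_unique[OF p, of i l "w j"] off that ij i
      by (metis nat_neq_iff)
    have "\<delta> (p n) (p i) \<le> n - i"
      using walk_dist_le[OF rayD(1)[OF p] i(2) order_refl]
        dist_sym[OF rayD(4)[OF p i(2)] rayD(4)[OF p order_refl]] by simp
    moreover have "\<delta> (w j) (w m) \<le> m - j" using walk_dist_le[OF rayD(1)[OF w] j(2) order_refl] .
    moreover have "\<delta> (p n) (w m) \<le> \<delta> (p n) (p i) + (\<delta> (p i) (w j) + \<delta> (w j) (w m))"
      using dist_triangle[of "p n" "p i" "w m"] dist_triangle[of "p i" "w j" "w m"]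
        rayD(4)[OF p i(2)] rayD(4)[OF p order_refl] rayD(4)[OF w j(2)] rayD(4)[OF w order_refl] by linarith
    ultimately have d: "\<delta> (p n) (w m) \<le> (n - i) + 1 + (m - j)" using dist_adj[OF ij] by linarith
    have "g + ((n - i) + 1 + (m - j)) \<le> induced_tree_number G"
    proof (cases "j = 1")
      case False
      \<comment> \<open>From \<open>w 2\<close> on, the second ray has no neighbour on
        \<open>C\<close>, so its tail sees only \<open>p i\<close>.\<close>
      then have j2: "2 \<le> j" using j by simp
      obtain y where y: "y \<in> C" "y \<notin> {p 0}" by (rule cycle_avoiding[of "{p 0}"]) auto
      let ?S = "C - {y} \<union> p ` {1..n}"
      have S: "itree (C - {y})" "card (C - {y}) = g - 1" using cycle_minus_vertex[OF y(1)] by auto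
      have S': "itree ?S \<and> card ?S = card (C - {y}) + n"
        by (rule attach_ray) (use S p y rayD(2) in auto)
      have "card ?S + (m - j + 1) \<le> induced_tree_number G"
      proof (rule attach_tail[where z = "p i" and p = w])
        show "s \<noteq> w l \<and> (s \<sim> w l \<longrightarrow> l = j \<and> s = p i)" if s: "s \<in> ?S" "j \<le> l" "l \<le> m" for s l
        proof (cases "s \<in> C")
          case True
          have "w l \<notin> C" using rayD(5)[OF w] s j by simp
          then have "s \<noteq> w l" using True by blast
          then show ?thesis using True ray_cycle_neighbour[OF w, of l s] s(2,3) j2 by auto
        next
          case False
          then obtain t where t: "s = p t" "1 \<le> t" "t \<le> n" using s(1) by auto
          then show ?thesis using ne[of t l] later[of t l] uniq[of t] s by (cases "l = j") auto
        qed
      qed (use S' w j ij i in auto)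
      then show ?thesis using S' S(2) i(1,2) g5 by linarith
    next
      case True
      \<comment> \<open>Hence the foot of \<open>w\<close> survives the deletion of
        \<open>p 0\<close>. With a common foot, \<open>w 1\<close> would have the two neighbours
        \<open>p 0\<close> and \<open>p i\<close> on the first ray.\<close>
      have w0: "w 0 \<noteq> p 0"
      proof
        assume "w 0 = p 0"
        then have "p 0 \<sim> w j" using rayD(6)[OF w, of 0] j True by simp
        then show False using uniq[of 0] i by simp
      qed
      let ?S = "C - {p 0} \<union> w ` {1..m}"
      have S: "itree (C - {p 0})" "card (C - {p 0}) = g - 1" using cycle_minus_vertex[OF rayD(2)[OF p]] by auto
      have S': "itree ?S \<and> card ?S = card (C - {p 0}) + m"
        by (rule attach_ray) (use S w w0 rayD(2) in auto)
      have "card ?S + (n - i + 1) \<le> induced_tree_number G"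
      proof (rule attach_tail[where z = "w j" and p = p])
        show "s \<noteq> p l \<and> (s \<sim> p l \<longrightarrow> l = i \<and> s = w j)" if s: "s \<in> ?S" "i \<le> l" "l \<le> n" for s l
        proof (cases "s \<in> C")
          case inC: True
          have "p l \<notin> C" using rayD(5)[OF p] s i by simp
          moreover have "s \<notin> w ` {1..m}" using inC rayD(5)[OF w] by (metis atLeastAtMost_iff imageE)
          then have "s \<noteq> p 0" using s(1) by blast
          moreover have "s \<noteq> p l" using calculation(1) inC by blast
          ultimately show ?thesis using inC ray_cycle_neighbour[OF p, of l s] s(2,3) i by auto
        next
          case False
          then obtain t where t: "s = w t" "1 \<le> t" "t \<le> m" using s(1) by auto
          have "\<not> w t \<sim> p l" if "t \<noteq> 1" using later[of l t] adj_sym t s i that True by auto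
          moreover have "l = i" if "w j \<sim> p l" using uniq[of l] adj_sym that s by auto
          ultimately show ?thesis using ne[of l t] t s i True by auto
        qed
        show "w j \<sim> p i" using ij adj_sym by blast
      qed (use S' p i True j in auto)
      then show ?thesis using S' S(2) True j(2) g5 by linarith
    qed
    then show ?thesis using d i j g5 by linarith
  qed
qed

lemma girth_five_bound:
  assumes "1 \<le> max_dist_periphery G"
  shows "max_dist_periphery G + (g - g div 3) \<le> induced_tree_number G"
proof (rule ccontr)
  define f where "f = max_dist_periphery G"
  define k where "k = g div 3"
  have k: "1 \<le> k" "k \<le> g" using g5 by (auto simp: k_def)
  assume "\<not> ?thesis"
  then have small: "induced_tree_number G + k < f + g" using k(2) by (simp add: f_def k_def)
  obtain x where x: "x \<in> verts G" "\<And>y. y \<in> periphery G \<Longrightarrow> f \<le> \<delta> x y" "x \<notin> periphery G"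
    using farthest_from_periphery assms unfolding f_def by (metis not_one_le_zero)
  obtain u v where uv: "u \<in> verts G" "v \<in> verts G" "\<delta> u v = diam" by (rule diametral_pair)
  have per: "u \<in> periphery G" "v \<in> periphery G"
    using peripheryI[OF uv] peripheryI[OF uv(2,1)] uv dist_sym by auto
  have xu: "f \<le> \<delta> x u" "f \<le> \<delta> x v" using x(2) per by auto
  have "\<delta> x u \<noteq> diam" using peripheryI[OF x(1) uv(1)] x(3) by blast
  then have fD: "f < diam" using xu(1) dist_le_diam[OF x(1) uv(1)] by simp
  obtain pu pv px where ru: "ray pu (L u)" "pu (L u) = u" and rv: "ray pv (L v)" "pv (L v) = v"
    and rx: "ray px (L x)" "px (L x) = x" using ray_to uv(1,2) x(1) by metis
  \<comment> \<open>Touching rays would give a tree with at least \<open>g + f\<close> vertices, too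
    many since \<open>1 \<le> k\<close>.\<close>
  have nt: "\<not> touching p (L a) q (L b)"
    if "ray p (L a)" "p (L a) = a" "ray q (L b)" "q (L b) = b" "f \<le> \<delta> a b" for p q a b
    using touching_rays[OF that(1,3)] that small k by auto
  have sum: "L x + L u + L v + k \<le> f"
    using three_rays[OF rx(1) ru(1) rv(1)] nt rx ru rv xu fD uv(3) small g5 by fastforce
  have via: "\<delta> a b \<le> L a + \<delta> (p 0) (q 0) + L b"
    if "ray p (L a)" "p (L a) = a" "ray q (L b)" "q (L b) = b" for p q a b
  proof -
    have v: "p 0 \<in> verts G" "q 0 \<in> verts G" "a \<in> verts G" "b \<in> verts G"
      using rayD(4)[OF that(1), of 0] rayD(4)[OF that(3), of 0] rayD(4)[OF that(1) order_refl]
        rayD(4)[OF that(3) order_refl] that by auto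
    have "\<delta> (p 0) a \<le> L a" "\<delta> (q 0) b \<le> L b"
      using walk_dist_le[OF rayD(1)[OF that(1)], of 0 "L a"] walk_dist_le[OF rayD(1)[OF that(3)], of 0 "L b"] that
      by auto
    then show ?thesis
      using dist_triangle[OF v(3) v(1) v(4)] dist_triangle[OF v(1,2,4)] dist_sym[OF v(1,3)] by linarith
  qed
  have "\<delta> (px 0) (pu 0) + \<delta> (pu 0) (pv 0) + \<delta> (px 0) (pv 0) \<le> g"
    using cycle_triangle[OF rayD(2)[OF rx(1)] rayD(2)[OF ru(1)] rayD(2)[OF rv(1)]] .
  \<comment> \<open>The three detours through the feet add up to
    \<open>diam + 2 * f \<le> 2 * (L x + L u + L v) + g\<close>; then \<open>sum\<close> is
    inserted.\<close>
  then have Dg: "diam + 2 * k \<le> g"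
    using via[OF rx ru] via[OF rx rv] via[OF ru rv] xu uv(3) sum by linarith
  have half: "\<delta> (c i) (c (i + int (g div 2))) = g div 2" for i by (rule isometric_half) simp
  have "g div 2 < diam"
  proof (rule ccontr)
    assume "\<not> g div 2 < diam"
    then have "\<delta> (c i) (c (i + int (g div 2))) = diam" for i
      using half[of i] dist_le_diam[of "c i" "c (i + int (g div 2))"] by simp
    then have "c i \<in> periphery G" for i using peripheryI[OF c_verts c_verts] by blast
    then have "px 0 \<in> periphery G" using rayD(2)[OF rx(1)] by (metis imageE)
    moreover have "\<delta> x (px 0) \<le> L x"
      using walk_dist_le[OF rayD(1)[OF rx(1)], of 0 "L x"] rx dist_sym[OF x(1), of "px 0"] rayD(4)[OF rx(1), of 0] by simp
    ultimately show False using x(2)[of "px 0"] sum k by linarith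
  qed
  \<comment> \<open>Together with \<open>Dg\<close> this gives
    \<open>4 * k + 1 \<le> g \<le> 3 * k + 2\<close>, so \<open>k = 1\<close>.\<close>
  moreover have "g \<le> 2 * (g div 2) + 1" "g < 3 * k + 3" unfolding k_def by linarith+
  ultimately have k1: "k = 1" using Dg k(1) by linarith
  then have g: "g = 5" using \<open>g < 3 * k + 3\<close> g5 by linarith
  then have D: "diam = 3" using Dg k1 \<open>g div 2 < diam\<close> by simp
  \<comment> \<open>Two vertices of a pentagon have distance at most 2, less than the
    diameter.\<close>
  have "\<exists>a\<in>{u, v}. L a \<noteq> 0"
  proof (rule ccontr)
    assume "\<not> (\<exists>a\<in>{u, v}. L a \<noteq> 0)"
    then have "u \<in> C" "v \<in> C" using L_0 uv by auto
    then have "\<delta> u v + \<delta> v u + \<delta> u u \<le> 5" using cycle_triangle[of u v u] g by blast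
    then show False using uv D dist_sym[OF uv(1,2)] by simp
  qed
  then obtain a where a: "a \<in> {u, v}" "L a \<noteq> 0" by blast
  have av: "a \<in> verts G" using a uv by auto
  have La: "L a = 1" and f2: "f = 2" using a sum fD D k1 by auto
  obtain pa where pa: "ray pa (L a)" "pa (L a) = a" using ray_to[OF av] by blast
  obtain i where i: "pa 0 = c i" using rayD(2)[OF pa(1)] by auto
  have ia: "c i \<sim> a" using rayD(6)[OF pa(1), of 0] La i pa(2) by simp
  have aC: "a \<notin> C" using L_0[OF av] La by simp
  \<comment> \<open>A second vertex off the pentagon would yield an induced tree with 6 vertices,
    whether or not the two rays touch, while now \<open>induced_tree_number G < 6\<close>.\<close>
  have only: "z = a" if "z \<in> verts G" "z \<notin> C" for z
  proof (rule ccontr)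
    assume "z \<noteq> a"
    obtain q where q: "ray q (L z)" "q (L z) = z" using ray_to \<open>z \<in> verts G\<close> by blast
    have "1 \<le> L z" "1 \<le> \<delta> a z"
      using L_0[of z] dist_eq_0[of a z] that av \<open>z \<noteq> a\<close> by auto
    show False
    proof (cases "touching pa (L a) q (L z)")
      case True
      then show False using touching_rays[OF pa(1) q(1)] pa q \<open>1 \<le> \<delta> a z\<close> small f2 g k1 by simp
    next
      case False
      moreover have "ray pa 0" using pa(1) by (simp add: ray_def walk_def)
      ultimately have "g - 1 + (L a + L z + 0) \<le> induced_tree_number G"
        using three_rays[OF pa(1) q(1), of pa 0] by (simp add: touching_def)
      then show False using La \<open>1 \<le> L z\<close> small f2 g k1 by simp
    qed
  qed
  have far: "\<delta> a y = 3" if y: "y \<in> C" "\<delta> (c i) y = 2" for y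
  proof -
    have yv: "y \<in> verts G" using y C_subset by blast
    have nay: "\<not> a \<sim> y"
    proof
      assume "a \<sim> y"
      then have "y = c i" using cycle_neighbour_unique[OF aC y(1) _ adj_sym ia] by blast
      then show False using y by simp
    qed
    have "\<delta> a y \<noteq> 0" using dist_eq_0[OF av yv] aC y by auto
    moreover have "\<delta> a y \<noteq> 1" using dist_le_1[OF av yv] nay aC y by auto
    moreover have "\<delta> a y \<noteq> 2"
    proof
      assume "\<delta> a y = 2"
      then obtain q where q: "q 0 = a" "q 2 = y" "walk q 2" using geodesic[OF av yv] by metis
      have z: "a \<sim> q 1" "q 1 \<sim> y" using walk_adj[OF q(3), of 0] walk_adj[OF q(3), of 1] q by (auto simp: numeral_2_eq_2)
      have "q 1 \<in> C" using only[of "q 1"] z adj_irrefl adj_in_verts by blast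
      then have "q 1 = c i" using cycle_neighbour_unique[OF aC _ _ adj_sym ia] z by blast
      then show False using dist_adj[OF z(2)] y by simp
    qed
    moreover have "\<delta> a y \<le> 3" using dist_le_diam[OF av yv] D by simp
    ultimately show ?thesis by linarith
  qed
  have c5: "c (5 + j) = c j" for j by (simp add: c_eq g)
  have "\<delta> (c i) (c (i + 2)) = 2" using isometric_half[of 2 i] g by simp
  moreover have "\<delta> (c i) (c (i + 3)) = 2"
    using isometric_half[of 2 "i + 3"] g c5[of i] dist_sym[of "c i" "c (i + 3)"] by simp
  ultimately have d3: "\<delta> a (c (i + 2)) = diam" "\<delta> a (c (i + 3)) = diam" using far D by auto
  \<comment> \<open>Every vertex of the pentagon is one of these three or adjacent to one, which
    contradicts \<open>f = 2\<close>.\<close>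
  then have P: "a \<in> periphery G" "c (i + 2) \<in> periphery G" "c (i + 3) \<in> periphery G"
    using peripheryI[OF av c_verts d3(1)] peripheryI[OF c_verts av] dist_sym[OF av c_verts] by auto
  have no: "\<not> x \<sim> y" "x \<noteq> y" if "y \<in> periphery G" for y
    using x(2)[OF that] dist_adj[of x y] f2 x(3) that by auto
  have "x \<in> C" using only[OF x(1)] x(3) P by blast
  then obtain l where l: "l < g" "x = c (i + int l)" by (rule C_at)
  then consider "l = 0" | "l = 1" | "l = 2" | "l = 3" | "l = 4" using g by linarith
  then show False
  proof cases
    case 1 then show False using no(1)[OF P(1)] ia l by simp
  next
    case 2 then show False using no(1)[OF P(2)] c_adj[of "i + 1"] l by (simp add: algebra_simps)
  next
    case 3 then show False using no(2)[OF P(2)] l by simp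
  next
    case 4 then show False using no(2)[OF P(3)] l by simp
  next
    case 5 then show False using no(1)[OF P(3)] adj_sym[OF c_adj[of "i + 3"]] l by (simp add: algebra_simps)
  qed
qed

end

text \<open>\<open>g - g div 3\<close> is the ceiling of \<open>2 * g / 3\<close> in natural
  numbers.\<close>

lemma (in shortest_cycle) tree_number_bound:
  "max_dist_periphery G + (g - g div 3) \<le> induced_tree_number G"
proof (cases "max_dist_periphery G = 0")
  case True
  have "g - 1 \<le> induced_tree_number G"
    using cycle_minus_vertex[of "c 0"] itree_card_le[of "C - {c 0}"] by auto
  then show ?thesis using True g3 by linarith
next
  case False
  define f where "f = max_dist_periphery G"
  obtain x where x: "x \<in> verts G" "\<And>y. y \<in> periphery G \<Longrightarrow> f \<le> \<delta> x y" "x \<notin> periphery G"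
    using farthest_from_periphery False unfolding f_def by metis
  obtain u v where uv: "u \<in> verts G" "v \<in> verts G" "\<delta> u v = diam" by (rule diametral_pair)
  have per: "u \<in> periphery G" "v \<in> periphery G"
    using peripheryI[OF uv] peripheryI[OF uv(2,1)] uv dist_sym by auto
  have ecc: "\<delta> x z < diam" if "z \<in> verts G" for z
    using dist_le_diam[OF x(1) that] peripheryI[OF x(1) that] x(3) by fastforce
  have fD: "f < diam" using ecc[OF uv(1)] x(2)[OF per(1)] by simp
  consider "g = 3" | "g = 4" | "5 \<le> g" using g3 by linarith
  then have "f + (g - g div 3) \<le> induced_tree_number G"
  proof cases
    case 1
    then show ?thesis using diam_bound fD by simp
  next
    case 2
    show ?thesis
    \<comment> \<open>Here \<open>f + 3\<close> vertices are needed. A diametral path provides them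
      unless the diameter is exactly \<open>f + 1\<close>.\<close>
    proof (cases "f + 1 = diam")
      case True
      then show ?thesis
        using girth_four_bound[OF 2 x(1) uv] ecc x(2)[OF per(1)] x(2)[OF per(2)] False 2 by (simp add: f_def)
    next
      case False
      then show ?thesis using diam_bound fD 2 by simp
    qed
  next
    case 3
    then interpret long_shortest_cycle G c g by unfold_locales
    show ?thesis using girth_five_bound False by (simp add: f_def)
  qed
  then show ?thesis by (simp add: f_def)
qed

theorem theorem3p1:
  fixes G :: "('a,'b) pre_digraph"
  assumes "graph G" and "Digraph_Component.connected G"
  shows "((\<exists>p. undirected_cycle G p) \<longrightarrow>
            int (induced_tree_number G)
              \<ge> int (max_dist_periphery G) + \<lceil>2 * real (girth G) / 3\<rceil>)
         \<and> real (induced_tree_number G)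
              \<ge> 2 / 3 * real (girth G) + real (max_dist_periphery G)"
proof -
  interpret graph G by fact
  interpret connected_graph G by unfold_locales fact
  let ?f = "max_dist_periphery G" and ?g = "girth G" and ?t = "induced_tree_number G"
  have cyc: "int ?f + \<lceil>2 * real ?g / 3\<rceil> \<le> int ?t" if p: "undirected_cycle G p" for p
  proof -
    obtain c where "shortest_cycle G c ?g" using ex_shortest_cycle[OF p] by blast
    then have "?f + (?g - ?g div 3) \<le> ?t" by (rule shortest_cycle.tree_number_bound)
    moreover have "\<lceil>2 * real ?g / 3\<rceil> \<le> int (?g - ?g div 3)"
      by (simp add: ceiling_le_iff)
    ultimately show ?thesis by linarith
  qed
  moreover have "2 / 3 * real ?g + real ?f \<le> real ?t"
  proof (cases "acyclic_graph G")
    case False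
    then obtain p where "undirected_cycle G p" by (auto simp: acyclic_graph_def)
    then have "real_of_int (int ?f + \<lceil>2 * real ?g / 3\<rceil>) \<le> real_of_int (int ?t)"
      using cyc of_int_le_iff by blast
    then show ?thesis by linarith
  next
    case True
    obtain x where x: "x \<in> verts G" "\<And>y. y \<in> periphery G \<Longrightarrow> ?f \<le> \<delta> x y"
      using farthest_from_periphery by metis
    obtain u v where uv: "u \<in> verts G" "v \<in> verts G" "\<delta> u v = diam" by (rule diametral_pair)
    \<comment> \<open>Without a cycle the girth is 0, and a diametral path is already large
      enough.\<close>
    have "?f \<le> diam" using x(2)[OF peripheryI[OF uv]] dist_le_diam[OF x(1) uv(1)] by simp
    then show ?thesis using diam_bound True by (simp add: girth_def)
  qed
  ultimately show ?thesis by blast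
qed

end
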